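(* (a) Let $\mathcal{C}$ be a honeycomb packing of unit circles in $\mathbb{R}^2$. Then for every line $H \subset \mathbb{R}^2$, every closed half-plane $H^+$ bounded by $H$, and every nonzero vector $\vec{v}$ perpendicular to $H$ and pointing in the direction of $H^+$, the packing $\widetilde{\mathcal{C}}$ obtained from $\mathcal{C}$ by introducing the gap defect determined by $(H, H^+, \vec{v})$ is not completely saturated. (b) Let $\mathcal{B}$ be an fcc (face-centered cubic lattice) packing of unit spheres in $\mathbb{R}^3$. Then for every plane $H \subset \mathbb{R}^3$, every closed half-space $H^+$ bounded by $H$, and every nonzero vector $\vec{v}$ perpendicular to $H$ and pointing in the direction of $H^+$, the packing $\widetilde{\mathcal{B}}$ obtained from $\mathcal{B}$ by introducing the gap defect determined by $(H, H^+, \vec{v})$ is not completely saturated.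
   Context: A packing of unit spheres in $\mathbb{R}^n$ (unit circles when $n=2$) is a collection of balls of radius $1$ with pairwise disjoint interiors; it is identified with its set of centers $X \subset \mathbb{R}^n$, so that $X$ is a packing if and only if any two distinct points of $X$ are at distance at least $2$. For an integer $k \ge 1$, a packing of unit spheres is $k$-saturated if it is not possible to replace $k-1$ of its spheres by $k$ spheres and still have a packing. In terms of centers: there do not exist a subset $A \subset X$ with $|A| = k-1$ and a set $B \subset \mathbb{R}^n$ with $|B| = k$ and $B \cap (X \setminus A) = \emptyset$ such that $(X \setminus A) \cup B$ is a packing. A packing is completely saturated if it is $k$-saturated for all $k \ge 1$. Gap defect: let $X \subset \mathbb{R}^n$ be (the set of centers of) a sphere packing, $H \subset \mathbb{R}^n$ a hyperplane (a line if $n=2$, a plane if $n=3$; affine, not necessarily through the origin), $H^+$ a closed half-space bounded by $H$, and $\vec{v} \neq 0$ a vector perpendicular to $H$ in the direction of $H^+$ (i.e. $H^+ + \vec{v} \subset H^+$). The packing obtained from $X$ by introducing the gap defect determined by $(H, H^+, \vec{v})$ has set of centers $$\widetilde{X} = \{x \in X : x \notin H^+\} \cup \{x + \vec{v} : x \in X \cap H^+\}.$$ This is again a packing. The number $\|\vec{v}\|$ is the width of the gap. A honeycomb circle packing in $\mathbb{R}^2$ is a packing of unit circles whose set of centers is congruent to $\{(2i+j, \sqrt{3}\,j) : i,j \in \mathbb{Z}\}$. An fcc packing in $\mathbb{R}^3$ is a packing of unit spheres whose set of centers is congruent to $\{(2i+k, 2j+k, \sqrt{2}\,k) : i,j,k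 \in \mathbb{Z}\}$. *)

theory Defs
  imports "HOL-Analysis.Analysis"
begin

text \<open>A packing of unit spheres is represented by its set of centers.\<close>

definition sphere_packing :: "'a::euclidean_space set \<Rightarrow> bool" where
  "sphere_packing X \<longleftrightarrow>
     pairwise (\<lambda>x y. interior (cball x 1) \<inter> interior (cball y 1) = {}) X"

lemma sphere_packing_iff_dist:
  fixes X :: "'a::euclidean_space set"
  shows "sphere_packing X \<longleftrightarrow> (\<forall>x\<in>X. \<forall>y\<in>X. x \<noteq> y \<longrightarrow> 2 \<le> dist x y)"
proof -
  have *: "ball x 1 \<inter> ball y 1 = {} \<longleftrightarrow> 2 \<le> dist x y" for x y :: 'a
  proof
    assume e: "ball x 1 \<inter> ball y 1 = {}"
    show "2 \<le> dist x y"
    proof (rule ccontr)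
      assume "\<not> 2 \<le> dist x y"
      moreover have "dist x (midpoint x y) = dist x y / 2" "dist y (midpoint x y) = dist x y / 2"
        by (simp_all add: dist_midpoint)
      ultimately have "midpoint x y \<in> ball x 1 \<inter> ball y 1" by simp
      then show False using e by blast
    qed
  qed (rule disjoint_ballI, simp)
  show ?thesis unfolding sphere_packing_def pairwise_def interior_cball * by blast
qed

text \<open>
  Finiteness of \<open>A\<close> is explicit because \<open>card\<close> is \<open>0\<close> on infinite sets, which matters for
  \<open>k = 1\<close>; for \<open>B\<close> it follows from \<open>card B = k\<close> and \<open>k \<ge> 1\<close>, the only range in which the
  notion is used.
\<close>

definition k_saturated :: "nat \<Rightarrow> 'a::euclidean_space set \<Rightarrow> bool" where
  "k_saturated k X \<longleftrightarrow>
     \<not> (\<exists>A B. A \<subseteq> X \<and> finite A \<and> card A = k - 1 \<and> finite B \<and> card B = k \<and>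
            B \<inter> (X - A) = {} \<and> sphere_packing ((X - A) \<union> B))"

definition completely_saturated :: "'a::euclidean_space set \<Rightarrow> bool" where
  "completely_saturated X \<longleftrightarrow> (\<forall>k\<ge>1. k_saturated k X)"

text \<open>\<open>P\<close> is a closed half-space whose bounding (affine) hyperplane is \<open>H\<close>.\<close>

definition closed_halfspace_bounded_by ::
    "'a::euclidean_space set \<Rightarrow> 'a set \<Rightarrow> bool" where
  "closed_halfspace_bounded_by P H \<longleftrightarrow>
     (\<exists>a b. a \<noteq> 0 \<and> H = {x. a \<bullet> x = b} \<and> P = {x. a \<bullet> x \<ge> b})"

definition perpendicular_to :: "'a::euclidean_space \<Rightarrow> 'a set \<Rightarrow> bool" where
  "perpendicular_to v H \<longleftrightarrow> (\<forall>x\<in>H. \<forall>y\<in>H. v \<bullet> (x - y) = 0)"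

definition gap_data :: "'a::euclidean_space set \<Rightarrow> 'a set \<Rightarrow> 'a \<Rightarrow> bool" where
  "gap_data H P v \<longleftrightarrow>
     closed_halfspace_bounded_by P H \<and> v \<noteq> 0 \<and> perpendicular_to v H \<and>
     (\<lambda>x. x + v) ` P \<subseteq> P"

definition gap_defect :: "'a::euclidean_space set \<Rightarrow> 'a set \<Rightarrow> 'a \<Rightarrow> 'a set" where
  "gap_defect X P v = {x \<in> X. x \<notin> P} \<union> (\<lambda>x. x + v) ` (X \<inter> P)"

lemma gap_data_normal:
  assumes "gap_data H P v"
  obtains b where "H = {x. v \<bullet> x = b}" "P = {x. v \<bullet> x \<ge> b}"
proof -
  from assms obtain a b where a: "a \<noteq> 0" and H: "H = {x. a \<bullet> x = b}" and P: "P = {x. a \<bullet> x \<ge> b}"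
    by (auto simp: gap_data_def closed_halfspace_bounded_by_def)
  define c where "c = (a \<bullet> v) / (a \<bullet> a)"
  define w where "w = v - c *\<^sub>R a"
  define z where "z = (b / (a \<bullet> a)) *\<^sub>R a"
  have aw: "a \<bullet> w = 0" using a by (simp add: w_def c_def inner_diff_right)
  have az: "a \<bullet> z = b" using a by (simp add: z_def)
  have "z \<in> H" "z + w \<in> H" using aw az by (simp_all add: H inner_add_right)
  then have "v \<bullet> ((z + w) - z) = 0"
    using assms unfolding gap_data_def perpendicular_to_def by blast
  then have "v \<bullet> w = 0" by simp
  then have "w \<bullet> w = 0" using aw by (simp add: w_def inner_diff_left)
  then have v: "v = c *\<^sub>R a" by (simp add: w_def)
  have "z \<in> P" using az by (simp add: P)
  then have "z + v \<in> P" using assms by (auto simp: gap_data_def)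
  then have "a \<bullet> v \<ge> 0" using az by (simp add: P inner_add_right)
  then have "c \<ge> 0" by (simp add: c_def)
  moreover have "c \<noteq> 0" using v assms by (auto simp: gap_data_def)
  ultimately have c: "c > 0" by simp
  show thesis
    by (rule that[of "c * b"]) (use c in \<open>auto simp: H P v\<close>)
qed

lemma sphere_packing_gap_defect:
  assumes X: "sphere_packing X" and "gap_data H P v"
  shows "sphere_packing (gap_defect X P v)"
proof -
  obtain b where P: "P = {x. v \<bullet> x \<ge> b}" using gap_data_normal[OF assms(2)] by metis
  have *: "2 \<le> dist x (y + v)" if "x \<in> X" "y \<in> X" "x \<notin> P" "y \<in> P" for x y
  proof -
    have "v \<bullet> (x - y) \<le> 0" using that by (simp add: P inner_diff_right)
    moreover have "(norm ((x - y) - v))\<^sup>2 = (norm (x - y))\<^sup>2 + (norm v)\<^sup>2 - 2 * (v \<bullet> (x - y))"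
      by (simp add: power2_norm_eq_inner inner_diff_left inner_diff_right inner_commute)
    ultimately have "(norm (x - y))\<^sup>2 \<le> (norm ((x - y) - v))\<^sup>2"
      using zero_le_power2[of "norm v"] by linarith
    then have "norm (x - y) \<le> norm ((x - y) - v)" by (simp add: power2_le_iff_abs_le)
    moreover have "x \<noteq> y" using that by auto
    then have "2 \<le> norm (x - y)"
      using X that(1,2) by (simp add: sphere_packing_iff_dist dist_norm)
    ultimately show ?thesis by (simp add: dist_norm diff_diff_eq)
  qed
  have **: "2 \<le> dist (y + v) x" if "x \<in> X" "y \<in> X" "x \<notin> P" "y \<in> P" for x y
    using *[OF that] by (simp add: dist_commute)
  show ?thesis
    using X * ** unfolding sphere_packing_iff_dist gap_defect_def by auto
qed

definition congruent_sets :: "'a::metric_space set \<Rightarrow> 'a set \<Rightarrow> bool" where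
  "congruent_sets S T \<longleftrightarrow>
     (\<exists>f. bij f \<and> (\<forall>x y. dist (f x) (f y) = dist x y) \<and> T = f ` S)"

definition honeycomb_packing :: "(real^2) set \<Rightarrow> bool" where
  "honeycomb_packing X \<longleftrightarrow>
     sphere_packing X \<and>
     congruent_sets
       {vector [2 * of_int i + of_int j, sqrt 3 * of_int j] | i j :: int. True} X"

definition fcc_packing :: "(real^3) set \<Rightarrow> bool" where
  "fcc_packing X \<longleftrightarrow>
     sphere_packing X \<and>
     congruent_sets
       {vector [2 * of_int i + of_int k, 2 * of_int j + of_int k, sqrt 2 * of_int k]
         | i j k :: int. True} X"

lemma sphere_packing_congruent:
  assumes "congruent_sets S T" "sphere_packing S"
  shows "sphere_packing T"
  using assms unfolding congruent_sets_def sphere_packing_iff_dist by fastforce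

lemma honeycomb_packing_iff_congruent:
  "honeycomb_packing X \<longleftrightarrow> congruent_sets
     {vector [2 * of_int i + of_int j, sqrt 3 * of_int j] | i j :: int. True} X"
proof -
  have dist_ge: "2 \<le> dist (vector [2 * of_int i + of_int j, sqrt 3 * of_int j] :: real^2)
                 (vector [2 * of_int i' + of_int j', sqrt 3 * of_int j'])" (is "2 \<le> dist ?x ?y")
    if "i \<noteq> i' \<or> j \<noteq> j'" for i j i' j' :: int
  proof -
    define m n where "m = i - i'" and "n = j - j'"
    have "m\<^sup>2 + m * n + n\<^sup>2 > 0"
    proof -
      have "4 * (m\<^sup>2 + m * n + n\<^sup>2) = (2 * m + n)\<^sup>2 + 3 * n\<^sup>2"
        by (simp add: power2_eq_square algebra_simps)
      moreover have "(2 * m + n)\<^sup>2 + 3 * n\<^sup>2 > 0"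
      proof (cases "n = 0")
        case True then show ?thesis using that by (auto simp: m_def n_def)
      next
        case False then have "n\<^sup>2 > 0" by simp
        then show ?thesis using zero_le_power2[of "2 * m + n"] by linarith
      qed
      ultimately have "0 < 4 * (m\<^sup>2 + m * n + n\<^sup>2)" by (simp only:)
      then show ?thesis by (rule zero_less_mult_pos) simp
    qed
    then have "real_of_int (m\<^sup>2 + m * n + n\<^sup>2) \<ge> 1"
      by (metis of_int_1_le_iff int_one_le_iff_zero_less)
    moreover have "(dist ?x ?y)\<^sup>2 = 4 * real_of_int (m\<^sup>2 + m * n + n\<^sup>2)"
    proof -
      have eqs:
        "2 * real_of_int i + of_int j - (2 * of_int i' + of_int j') = 2 * of_int m + of_int n"
        "sqrt 3 * real_of_int j - sqrt 3 * of_int j' = sqrt 3 * of_int n"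
        by (simp_all add: m_def n_def algebra_simps)
      have "(dist ?x ?y)\<^sup>2 = (2 * of_int m + of_int n)\<^sup>2 + (sqrt 3 * of_int n)\<^sup>2"
        by (simp only: dist_vec_def L2_set_def sum_2 dist_real_def vector_2 eqs power2_abs
            real_sqrt_pow2 sum_power2_ge_zero zero_le_power2 add_nonneg_nonneg)
      then show ?thesis
        by (simp add: power_mult_distrib) (simp add: power2_eq_square algebra_simps)
    qed
    ultimately have "2\<^sup>2 \<le> (dist ?x ?y)\<^sup>2" by simp
    then show ?thesis by (rule power2_le_imp_le) simp
  qed
  have "sphere_packing
      {vector [2 * of_int i + of_int j, sqrt 3 * of_int j] :: real^2 | i j :: int. True}"
    unfolding sphere_packing_iff_dist
  proof (intro ballI impI)
    fix x y :: "real^2"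
    assume "x \<in> {vector [2 * of_int i + of_int j, sqrt 3 * of_int j] | i j :: int. True}"
      and "y \<in> {vector [2 * of_int i + of_int j, sqrt 3 * of_int j] | i j :: int. True}"
      and "x \<noteq> y"
    then obtain i j i' j' :: int where xy:
        "x = vector [2 * of_int i + of_int j, sqrt 3 * of_int j]"
        "y = vector [2 * of_int i' + of_int j', sqrt 3 * of_int j']"
      by blast
    with \<open>x \<noteq> y\<close> have "i \<noteq> i' \<or> j \<noteq> j'" by auto
    then show "2 \<le> dist x y" unfolding xy by (rule dist_ge)
  qed
  then show ?thesis unfolding honeycomb_packing_def using sphere_packing_congruent by blast
qed

lemma fcc_packing_iff_congruent:
  "fcc_packing X \<longleftrightarrow> congruent_sets
     {vector [2 * of_int i + of_int k, 2 * of_int j + of_int k, sqrt 2 * of_int k]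
       | i j k :: int. True} X"
proof -
  have dist_ge: "2 \<le> dist
      (vector [2 * of_int i + of_int k, 2 * of_int j + of_int k, sqrt 2 * of_int k] :: real^3)
      (vector [2 * of_int i' + of_int k', 2 * of_int j' + of_int k', sqrt 2 * of_int k'])"
      (is "2 \<le> dist ?x ?y")
    if "i \<noteq> i' \<or> j \<noteq> j' \<or> k \<noteq> k'" for i j k i' j' k' :: int
  proof -
    define l m n where "l = i - i'" and "m = j - j'" and "n = k - k'"
    have "l\<^sup>2 + m\<^sup>2 + n\<^sup>2 + l * n + m * n > 0"
    proof -
      have "4 * (l\<^sup>2 + m\<^sup>2 + n\<^sup>2 + l * n + m * n) = (2 * l + n)\<^sup>2 + (2 * m + n)\<^sup>2 + 2 * n\<^sup>2"
        by (simp add: power2_eq_square algebra_simps)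
      moreover have "(2 * l + n)\<^sup>2 + (2 * m + n)\<^sup>2 + 2 * n\<^sup>2 > 0"
      proof (cases "n = 0")
        case True
        then have "l \<noteq> 0 \<or> m \<noteq> 0" using that by (auto simp: l_def m_def n_def)
        then have "l\<^sup>2 > 0 \<or> m\<^sup>2 > 0" by simp
        then show ?thesis using True zero_le_power2[of l] zero_le_power2[of m]
          by (auto simp add: power_mult_distrib intro: add_pos_nonneg add_nonneg_pos)
      next
        case False then have "n\<^sup>2 > 0" by simp
        then show ?thesis using zero_le_power2[of "2 * l + n"] zero_le_power2[of "2 * m + n"]
          by linarith
      qed
      ultimately have "0 < 4 * (l\<^sup>2 + m\<^sup>2 + n\<^sup>2 + l * n + m * n)" by (simp only:)
      then show ?thesis by (rule zero_less_mult_pos) simp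
    qed
    then have "real_of_int (l\<^sup>2 + m\<^sup>2 + n\<^sup>2 + l * n + m * n) \<ge> 1"
      by (metis of_int_1_le_iff int_one_le_iff_zero_less)
    moreover have "(dist ?x ?y)\<^sup>2 = 4 * real_of_int (l\<^sup>2 + m\<^sup>2 + n\<^sup>2 + l * n + m * n)"
    proof -
      have eqs:
        "2 * real_of_int i + of_int k - (2 * of_int i' + of_int k') = 2 * of_int l + of_int n"
        "2 * real_of_int j + of_int k - (2 * of_int j' + of_int k') = 2 * of_int m + of_int n"
        "sqrt 2 * real_of_int k - sqrt 2 * of_int k' = sqrt 2 * of_int n"
        by (simp_all add: l_def m_def n_def algebra_simps)
      have "(dist ?x ?y)\<^sup>2 =
          (2 * of_int l + of_int n)\<^sup>2 + (2 * of_int m + of_int n)\<^sup>2 + (sqrt 2 * of_int n)\<^sup>2"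
        by (simp only: dist_vec_def L2_set_def sum_3 dist_real_def vector_3 eqs power2_abs
            real_sqrt_pow2 sum_power2_ge_zero zero_le_power2 add_nonneg_nonneg)
      then show ?thesis
        by (simp add: power_mult_distrib) (simp add: power2_eq_square algebra_simps)
    qed
    ultimately have "2\<^sup>2 \<le> (dist ?x ?y)\<^sup>2" by simp
    then show ?thesis by (rule power2_le_imp_le) simp
  qed
  have "sphere_packing
      {vector [2 * of_int i + of_int k, 2 * of_int j + of_int k, sqrt 2 * of_int k] :: real^3
        | i j k :: int. True}"
    unfolding sphere_packing_iff_dist
  proof (intro ballI impI)
    fix x y :: "real^3"
    assume "x \<in> {vector [2 * of_int i + of_int k, 2 * of_int j + of_int k, sqrt 2 * of_int k] | i j k :: int. True}"
      and "y \<in> {vector [2 * of_int i + of_int k, 2 * of_int j + of_int k, sqrt 2 * of_int k] | i j k :: int. True}"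
      and "x \<noteq> y"
    then obtain i j k i' j' k' :: int where xy:
        "x = vector [2 * of_int i + of_int k, 2 * of_int j + of_int k, sqrt 2 * of_int k]"
        "y = vector [2 * of_int i' + of_int k', 2 * of_int j' + of_int k', sqrt 2 * of_int k']"
      by blast
    with \<open>x \<noteq> y\<close> have "i \<noteq> i' \<or> j \<noteq> j' \<or> k \<noteq> k'" by auto
    then show "2 \<le> dist x y" unfolding xy by (rule dist_ge)
  qed
  then show ?thesis unfolding fcc_packing_def using sphere_packing_congruent by blast
qed

end

(*
Both lattices are A_n lattices (n = 2, 3): differences of the vertices of a regular simplex.
A gap with shift t is first replaced by a gap along a facet direction of the simplex ("vertex
gap"), then by wider and wider vertex gaps, until the shift is itself a shortest lattice vector;
such a gap is a layer of vacancies, into which a ball can be inserted.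

Each replacement moves finitely many balls and reproduces the new gap exactly in an arbitrarily
large ball, which is enough because a witness of unsaturation is finite. A thick, very long slab
below the gap is moved into the gap, its two halves in different directions, so that a new
gap opens between them; the displacement must fade out along the slab. Fading compresses the
slab, and the room comes from a zigzag: the balls are coloured such that neighbours have different
colours, and shifted along the normal by an amount depending on the colour. This lengthens each
horizontal bond by a fixed second order amount, so a sufficiently slow decay is affordable.

A shift D keeps two lattice points at difference e apart if e . D >= 0, so what counts about a
vertex gap at w p is its slack t . (w k - w p). The two halves may move by anything
between 0 and t in this sense, and for the cut at w q the slacks of w p and w q add up: this is
why the gaps grow.
*)

theory Submission
  imports Defs
begin

section \<open>Improvable packings\<close>

text \<open>Any positive gain is allowed, instead of an exchange of exactly \<open>k - 1\<close>
  balls for \<open>k\<close>. In this form the property survives a prior rearrangement of finitely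
  many balls.\<close>

definition improvable :: "'a::euclidean_space set \<Rightarrow> bool" where
  "improvable X \<longleftrightarrow>
     (\<exists>A B. finite A \<and> finite B \<and> A \<subseteq> X \<and> B \<inter> (X - A) = {} \<and> card A < card B \<and>
            sphere_packing ((X - A) \<union> B))"

lemma sphere_packing_subset: "sphere_packing X \<Longrightarrow> Y \<subseteq> X \<Longrightarrow> sphere_packing Y"
  unfolding sphere_packing_def using pairwise_subset by blast

text \<open>Surplus balls of \<open>B\<close> can be discarded, because a subset of a packing is a
  packing; keeping \<open>card A + 1\<close> of them refutes saturation for that
  \<open>k\<close>.\<close>

lemma improvable_imp_not_completely_saturated:
  assumes "improvable X"
  shows "\<not> completely_saturated X"
proof -
  obtain A B where AB: "finite A" "finite B" "A \<subseteq> X" "B \<inter> (X - A) = {}" "card A < card B"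
    "sphere_packing ((X - A) \<union> B)"
    using assms unfolding improvable_def by blast
  obtain C where C: "C \<subseteq> B" "card C = Suc (card A)" "finite C"
    using obtain_subset_with_card_n[of "Suc (card A)" B] AB(5) by auto
  have "sphere_packing ((X - A) \<union> C)"
    using C(1) by (intro sphere_packing_subset[OF AB(6)]) auto
  moreover have "C \<inter> (X - A) = {}" "card A = Suc (card A) - 1" using C AB(4) by auto
  ultimately have "\<not> k_saturated (Suc (card A)) X"
    unfolding k_saturated_def using AB(1,3) C(2,3) by blast
  then show ?thesis unfolding completely_saturated_def by force
qed

text \<open>Rearranging \<open>F\<close> into \<open>F'\<close> and then improving is itself one
  improvement: the rearrangement touches finitely many balls and does not change their
  number.\<close>

lemma improvable_exchange:
  assumes imp: "improvable (R \<union> F')"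
    and fin: "finite F" "finite F'" and card: "card F = card F'"
    and dis: "R \<inter> F = {}" "R \<inter> F' = {}"
  shows "improvable (R \<union> F)"
proof -
  obtain A B where AB: "finite A" "finite B" "A \<subseteq> R \<union> F'" "B \<inter> (R \<union> F' - A) = {}"
    "card A < card B" "sphere_packing ((R \<union> F' - A) \<union> B)"
    using imp unfolding improvable_def by blast
  \<comment> \<open>All of \<open>F\<close> is taken out; put in are \<open>B\<close> and those
    balls of \<open>F'\<close> that the given improvement leaves in place.\<close>
  define A2 where "A2 = (A \<inter> R) \<union> F"
  define B2 where "B2 = B \<union> (F' - A)"
  have "card A2 = card (A \<inter> R) + card F"
    unfolding A2_def using AB fin dis by (intro card_Un_disjoint) auto
  moreover have "card B2 = card B + card (F' - A)"
    unfolding B2_def using AB fin by (intro card_Un_disjoint) auto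
  moreover have "card F' = card (F' \<inter> A) + card (F' - A)"
    using fin card_Int_Diff by blast
  moreover have "card A = card (A \<inter> R) + card (F' \<inter> A)"
  proof -
    have "A = (A \<inter> R) \<union> (F' \<inter> A)" using AB by auto
    moreover have "card ((A \<inter> R) \<union> (F' \<inter> A)) = card (A \<inter> R) + card (F' \<inter> A)"
      using AB dis by (intro card_Un_disjoint) auto
    ultimately show ?thesis by simp
  qed
  ultimately have "card A2 < card B2" using AB card by linarith
  moreover have "(R \<union> F - A2) \<union> B2 \<subseteq> (R \<union> F' - A) \<union> B"
    unfolding A2_def B2_def using dis by auto
  then have "sphere_packing ((R \<union> F - A2) \<union> B2)" using AB sphere_packing_subset by blast
  moreover have "B2 \<inter> (R \<union> F - A2) = {}" unfolding A2_def B2_def using AB dis by auto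
  moreover have "finite A2" "finite B2" "A2 \<subseteq> R \<union> F" unfolding A2_def B2_def using AB fin by auto
  ultimately show ?thesis
    unfolding improvable_def by (intro exI[of _ A2] exI[of _ B2]) simp
qed

text \<open>A witness is finite, so it lies within some radius \<open>r\<close>. A center at
  distance at least \<open>r + 2\<close> is at distance at least 2 from every inserted one, so only
  the packing within radius \<open>r + 2\<close> matters.\<close>

lemma improvable_local:
  assumes "improvable Y"
  obtains \<rho> where "\<rho> > 0"
    "\<And>X \<zeta>. sphere_packing X \<Longrightarrow> (\<And>p. norm (p - \<zeta>) < \<rho> \<Longrightarrow> p \<in> X \<longleftrightarrow> p - \<zeta> \<in> Y) \<Longrightarrow> improvable X"
proof -
  obtain A B where AB: "finite A" "finite B" "A \<subseteq> Y" "B \<inter> (Y - A) = {}"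
    "card A < card B" "sphere_packing ((Y - A) \<union> B)"
    using assms unfolding improvable_def by blast
  have "bounded (A \<union> B)" using AB by (simp add: finite_imp_bounded)
  then obtain r where r: "r > 0" "\<And>x. x \<in> A \<union> B \<Longrightarrow> norm x \<le> r"
    unfolding bounded_pos by auto
  show thesis
  proof (rule that[of "r + 2"])
    fix X \<zeta>
    assume X: "sphere_packing X"
      and eq: "\<And>p. norm (p - \<zeta>) < r + 2 \<Longrightarrow> p \<in> X \<longleftrightarrow> p - \<zeta> \<in> Y"
    define A' where "A' = (+) \<zeta> ` A"
    define B' where "B' = (+) \<zeta> ` B"
    have near: "norm (p - \<zeta>) < r + 2" if "p \<in> A' \<union> B'" for p
    proof -
      from that obtain x where "x \<in> A \<union> B" "p = \<zeta> + x" unfolding A'_def B'_def by blast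
      then show ?thesis using r(2)[of x] by simp
    qed
    have A'X: "A' \<subseteq> X"
    proof
      fix p assume p: "p \<in> A'"
      then have "p - \<zeta> \<in> Y" using AB(3) unfolding A'_def by auto
      then show "p \<in> X" using eq[OF near[of p]] p by simp
    qed
    have memB: "p - \<zeta> \<in> B" if "p \<in> B'" for p using that unfolding B'_def by auto
    have memA: "p - \<zeta> \<in> A \<longleftrightarrow> p \<in> A'" for p
      unfolding A'_def by (auto intro: image_eqI[of _ _ "p - \<zeta>"])
    have dis: "B' \<inter> (X - A') = {}"
    proof (intro equals0I, elim IntE)
      fix p assume "p \<in> B'" "p \<in> X - A'"
      then have "p - \<zeta> \<in> B" "p - \<zeta> \<in> Y - A" using eq[OF near[of p]] memB memA[of p] by auto
      then show False using AB(4) by blast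
    qed
    have packY: "2 \<le> dist x y" if "x \<in> (Y - A) \<union> B" "y \<in> (Y - A) \<union> B" "x \<noteq> y" for x y
      using AB(6) that unfolding sphere_packing_iff_dist by simp
    have one: "2 \<le> dist p p'" if "p \<in> X - A'" "p' \<in> B'" for p p'
    proof (cases "norm (p - \<zeta>) < r + 2")
      case True
      then have "p - \<zeta> \<in> Y - A" using eq[of p] that(1) memA[of p] by auto
      moreover have "p' - \<zeta> \<in> B" using memB that(2) .
      moreover from calculation have "p - \<zeta> \<noteq> p' - \<zeta>" using AB(4) by auto
      ultimately have "2 \<le> dist (p - \<zeta>) (p' - \<zeta>)" by (intro packY) auto
      then show ?thesis by (simp add: dist_norm)
    next
      case False
      moreover have "norm (p' - \<zeta>) \<le> r" using memB[OF that(2)] r(2) by blast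
      moreover have "norm (p - \<zeta>) \<le> norm (p - p') + norm (p' - \<zeta>)"
        using norm_triangle_ineq[of "p - p'" "p' - \<zeta>"] by simp
      ultimately show ?thesis by (simp add: dist_norm)
    qed
    have two: "2 \<le> dist p p'" if "p \<in> B'" "p' \<in> B'" "p \<noteq> p'" for p p'
    proof -
      have "p - \<zeta> \<in> B" "p' - \<zeta> \<in> B" "p - \<zeta> \<noteq> p' - \<zeta>"
        using memB[OF that(1)] memB[OF that(2)] that(3) by simp_all
      then have "2 \<le> dist (p - \<zeta>) (p' - \<zeta>)" by (intro packY) auto
      then show ?thesis by (simp add: dist_norm)
    qed
    have packX: "2 \<le> dist p p'" if "p \<in> X" "p' \<in> X" "p \<noteq> p'" for p p'
      using X that unfolding sphere_packing_iff_dist by simp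
    have "sphere_packing ((X - A') \<union> B')"
      unfolding sphere_packing_iff_dist
    proof (intro ballI impI)
      fix x y assume "x \<in> (X - A') \<union> B'" "y \<in> (X - A') \<union> B'" "x \<noteq> y"
      then show "2 \<le> dist x y"
        using one[of x y] one[of y x] two[of x y] packX[of x y] by (auto simp: dist_commute)
    qed
    moreover have "card A' = card A" "card B' = card B"
      unfolding A'_def B'_def by (simp_all add: card_image)
    ultimately show "improvable X"
      unfolding improvable_def using AB(1,2,5) dis A'X
      by (intro exI[of _ A'] exI[of _ B']) (simp add: A'_def B'_def)
  qed (use r in simp)
qed

section \<open>Elementary estimates for displaced pairs and finite sets\<close>

text \<open>\<open>e\<close> stands for a bond and \<open>D\<close> for the relative displacement of
  its ends. The second order term is kept because it is what the zigzag contributes on horizontal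
  bonds.\<close>

lemma two_le_norm_add:
  fixes e D :: "'a::real_inner"
  assumes "2 \<le> norm e" "0 \<le> 2 * (e \<bullet> D) + (norm D)\<^sup>2"
  shows "2 \<le> norm (e + D)"
proof -
  have "(norm (e + D))\<^sup>2 = (norm e)\<^sup>2 + 2 * (e \<bullet> D) + (norm D)\<^sup>2"
    by (simp add: power2_norm_eq_inner inner_add_left inner_add_right inner_commute)
  moreover have "2\<^sup>2 \<le> (norm e)\<^sup>2" using assms(1) by (intro power_mono) auto
  ultimately have "2\<^sup>2 \<le> (norm (e + D))\<^sup>2" using assms(2) by linarith
  then show ?thesis by (rule power2_le_imp_le) simp
qed

lemma two_le_norm_add_inner:
  fixes e D :: "'a::real_inner"
  assumes "2 \<le> norm e" "0 \<le> e \<bullet> D"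
  shows "2 \<le> norm (e + D)"
  using assms by (intro two_le_norm_add) auto

lemma finite_positive_bound:
  fixes S :: "real set"
  assumes "finite S"
  obtains \<nu> where "\<nu> > 0" "\<And>x. x \<in> S \<Longrightarrow> x > 0 \<Longrightarrow> \<nu> \<le> x"
proof
  \<comment> \<open>Inserting 1 guarantees a minimum even if \<open>S\<close> has no positive
    element.\<close>
  show "0 < Min (insert 1 {x \<in> S. x > 0})" using assms by (subst Min_gr_iff) auto
  show "Min (insert 1 {x \<in> S. x > 0}) \<le> x" if "x \<in> S" "x > 0" for x
    using assms that by (intro Min_le) auto
qed

lemma sphere_packing_finite:
  fixes X :: "'a::euclidean_space set"
  assumes "sphere_packing X" "bounded X"
  shows "finite X"
proof -
  have "uniform_discrete X"
    using assms(1) unfolding sphere_packing_iff_dist by (intro uniformI2[of 2]) auto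
  then show ?thesis using assms(2) uniform_discrete_finite_iff by blast
qed

section \<open>Replacing a gap by another one\<close>

text \<open>Vectors that are not shortest have length at least 14/5, so such bonds tolerate a loss
  of 4/5. \<open>col\<close> is a proper colouring of the contact graph; its values are used as
  amplitudes of the zigzag.\<close>

locale colored_lattice =
  fixes L :: "'a::euclidean_space set" and col :: "'a \<Rightarrow> real" and K :: real
  assumes zero_mem: "0 \<in> L"
    and diff_mem: "x \<in> L \<Longrightarrow> y \<in> L \<Longrightarrow> x - y \<in> L"
    and norm_cases: "x \<in> L \<Longrightarrow> x \<noteq> 0 \<Longrightarrow> norm x = 2 \<or> 14/5 \<le> norm x"
    and col_nonneg: "x \<in> L \<Longrightarrow> 0 \<le> col x"
    and col_le: "x \<in> L \<Longrightarrow> col x \<le> K"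
    and col_diff: "x \<in> L \<Longrightarrow> y \<in> L \<Longrightarrow> norm (x - y) = 2 \<Longrightarrow> 1 \<le> \<bar>col x - col y\<bar>"
begin

text \<open>In contrast to \<open>gap_defect\<close>, the shift \<open>t\<close> is not tied to the
  normal \<open>N\<close>: the intermediate gaps open obliquely.\<close>

definition gap :: "'a \<Rightarrow> real \<Rightarrow> 'a \<Rightarrow> 'a set" where
  "gap N b t = (\<lambda>x. if N \<bullet> x < b then x else x + t) ` L"

lemma uminus_mem: "x \<in> L \<Longrightarrow> - x \<in> L"
  using diff_mem[OF zero_mem] by simp

lemma add_mem: "x \<in> L \<Longrightarrow> y \<in> L \<Longrightarrow> x + y \<in> L"
  using diff_mem[of x "- y"] uminus_mem by simp

lemma two_le_norm: "x \<in> L \<Longrightarrow> x \<noteq> 0 \<Longrightarrow> 2 \<le> norm x"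
  using norm_cases by force

lemma sphere_packing_L: "sphere_packing L"
  unfolding sphere_packing_iff_dist dist_norm using two_le_norm diff_mem by auto

lemma finite_bounded: "bounded S \<Longrightarrow> finite (L \<inter> S)"
  by (intro sphere_packing_finite sphere_packing_subset[OF sphere_packing_L]) auto

text \<open>There are only finitely many shortest vectors, so their positive inner products with
  \<open>N\<close> stay away from 0.\<close>

lemma min_inner:
  obtains \<nu> where "\<nu> > 0" "\<And>e. e \<in> L \<Longrightarrow> norm e = 2 \<Longrightarrow> 0 < N \<bullet> e \<Longrightarrow> \<nu> \<le> N \<bullet> e"
proof -
  have "finite (L \<inter> cball 0 2)" by (intro finite_bounded) simp
  then have "finite ((\<bullet>) N ` (L \<inter> cball 0 2))" by simp
  from finite_positive_bound[OF this] obtain \<nu> where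
    "\<nu> > 0" "\<And>x. x \<in> (\<bullet>) N ` (L \<inter> cball 0 2) \<Longrightarrow> x > 0 \<Longrightarrow> \<nu> \<le> x" by blast
  then show thesis by (intro that[of \<nu>]) auto
qed

end

text \<open>The slab is the set \<open>zone\<close> below. In its part \<open>inner_zone\<close> around \<open>q\<close> there is
  neither zigzag nor decay, so that the shifts are exactly those of the gap along the cut \<open>N' \<bullet> x = b'\<close>. Both sets are
  truncated cones, closed under steps along shortest vectors pointing up.\<close>

locale gap_shift = colored_lattice +
  fixes N N' t \<tau> \<sigma> q :: 'a
    and b b' \<beta> c \<epsilon> \<delta> a \<mu> \<nu> \<kappa> \<kappa>' R W :: real
  assumes nu: "\<nu> > 0" "\<And>e. e \<in> L \<Longrightarrow> norm e = 2 \<Longrightarrow> 0 < N \<bullet> e \<Longrightarrow> \<nu> \<le> N \<bullet> e"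
    and kappa: "\<kappa> > 0" "2 * \<kappa> \<le> \<nu>"
    and adm_t: "\<And>e. e \<in> L \<Longrightarrow> 0 < N \<bullet> e \<Longrightarrow> 2 \<le> norm (e + t)"
    and adm_low: "\<And>e z f s. e \<in> L \<Longrightarrow> 0 < N \<bullet> e \<Longrightarrow> 0 \<le> f \<Longrightarrow> f \<le> 1 \<Longrightarrow> c - \<epsilon> \<le> z \<Longrightarrow> z \<le> c \<Longrightarrow>
      s \<in> {\<sigma>, \<sigma> + \<tau>} \<Longrightarrow> 2 \<le> norm (e + (z *\<^sub>R N + f *\<^sub>R s))"
    and adm_high: "\<And>e z f s. e \<in> L \<Longrightarrow> 0 < N \<bullet> e \<Longrightarrow> 0 \<le> f \<Longrightarrow> f \<le> 1 \<Longrightarrow> c - \<epsilon> \<le> z \<Longrightarrow> z \<le> c \<Longrightarrow>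
      s \<in> {\<sigma>, \<sigma> + \<tau>} \<Longrightarrow> 2 \<le> norm (e + (t - (z *\<^sub>R N + f *\<^sub>R s)))"
    and c_eps: "0 \<le> c - \<epsilon>" "c * norm N \<le> 4/5" "\<epsilon> * norm N \<le> 1/10" "\<epsilon> \<ge> 0"
    and tau_min: "\<kappa>' > 0" "\<And>e. e \<in> L \<Longrightarrow> norm e = 2 \<Longrightarrow> 0 < N' \<bullet> e \<Longrightarrow> \<kappa>' \<le> e \<bullet> \<tau>"
    and tau_far: "\<And>e f. e \<in> L \<Longrightarrow> norm e \<noteq> 2 \<Longrightarrow> 0 < N' \<bullet> e \<Longrightarrow> 0 \<le> f \<Longrightarrow> f \<le> 1 \<Longrightarrow>
      9/4 \<le> norm (e + f *\<^sub>R \<tau>)"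
    and delta: "\<delta> > 0" "a > 0" "\<delta> * (b - \<beta>) + a * K \<le> \<epsilon>" "a * K \<le> \<delta> * \<nu> / 2"
    and R: "R > 0" "b - \<beta> \<le> \<kappa> * (R - 2)" "(2 + 2 * W) / R * (norm \<sigma> + norm \<tau>) \<le> \<mu>"
    and mu: "\<mu> \<ge> 0" "\<mu> \<le> 1/10" "4 * \<mu> \<le> \<delta> * \<nu>\<^sup>2" "16 * \<mu> \<le> (a * norm N)\<^sup>2"
      "\<mu> * (\<kappa>' + 2 * norm \<tau>) \<le> \<kappa>' * (a * norm N / 2)"
    and W: "norm t + c * norm N + norm \<sigma> + norm \<tau> \<le> W"
begin

section \<open>The displacement field on the slab\<close>

definition inner_zone where
  "inner_zone x \<longleftrightarrow> N \<bullet> x < b \<and> \<beta> \<le> N \<bullet> x - \<kappa> * norm (x - q)"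

definition zone where
  "zone x \<longleftrightarrow> N \<bullet> x < b \<and> \<beta> \<le> N \<bullet> x \<and>
     \<beta> - \<kappa> * (2 * R + (2 + 2 * W)) \<le> N \<bullet> x - \<kappa> * norm (x - q)"

text \<open>Outside the inner zone, the slope \<open>\<delta>\<close> stretches rising bonds to
  first order, and the term with \<open>a\<close> is the zigzag. The constant value \<open>c\<close>
  inside is the largest height that occurs on lattice points of the zone.\<close>

definition height where
  "height x = (if inner_zone x then c else c + \<delta> * (N \<bullet> x - b) - a * col x)"

text \<open>This is 1 up to radius \<open>R\<close>, 0 from radius \<open>2 * R\<close> on, and
  linear in between; a large \<open>R\<close> makes the decay as slow as desired.\<close>

definition cutoff where
  "cutoff x = max 0 (min 1 (2 - norm (x - q) / R))"

text \<open>The two halves of the slab move apart by \<open>\<tau>\<close>, which opens the new gap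
  between them.\<close>

definition side where
  "side x = (if N' \<bullet> x < b' then \<sigma> else \<sigma> + \<tau>)"

definition shift where
  "shift x = (if zone x then height x *\<^sub>R N + cutoff x *\<^sub>R side x
              else if N \<bullet> x < b then 0 else t)"

lemma W_nonneg: "0 \<le> W"
proof -
  have "0 \<le> c * norm N" using c_eps by (intro mult_nonneg_nonneg) auto
  then show ?thesis using W by (smt (verit) norm_ge_zero)
qed

lemma inner_zone_imp_zone: "inner_zone x \<Longrightarrow> zone x"
proof -
  assume i: "inner_zone x"
  have "0 \<le> \<kappa> * norm (x - q)" "0 \<le> \<kappa> * (2 * R + (2 + 2 * W))"
    using kappa R W_nonneg by auto
  then show "zone x" using i unfolding inner_zone_def zone_def by linarith
qed

lemma cutoff_bounds: "0 \<le> cutoff x" "cutoff x \<le> 1"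
  unfolding cutoff_def by auto

lemma cutoff_diff: "\<bar>cutoff y - cutoff x\<bar> \<le> norm (y - x) / R"
proof -
  have "\<bar>cutoff y - cutoff x\<bar> \<le> \<bar>norm (x - q) / R - norm (y - q) / R\<bar>"
    unfolding cutoff_def by (auto simp: max_def min_def abs_if)
  also have "\<dots> = \<bar>norm (x - q) - norm (y - q)\<bar> / R"
    using R by (simp add: diff_divide_distrib[symmetric])
  also have "\<dots> \<le> norm (y - x) / R"
    using R norm_triangle_ineq3[of "x - q" "y - q"]
    by (intro divide_right_mono) (auto simp: norm_minus_commute)
  finally show ?thesis .
qed

lemma cutoff_pos_imp: "0 < cutoff x \<Longrightarrow> norm (x - q) < 2 * R"
  using R unfolding cutoff_def by (auto simp: field_simps max_def min_def split: if_splits)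

text \<open>The thickness \<open>b - \<beta>\<close> and the opening \<open>\<kappa>\<close> confine
  the inner zone to radius \<open>R - 2\<close> around \<open>q\<close>, so the decay starts only
  beyond the neighbours of its points.\<close>

lemma cutoff_near_inner_zone:
  assumes "inner_zone x" "norm (y - x) \<le> 2"
  shows "cutoff y = 1"
proof -
  have "\<kappa> * norm (x - q) \<le> \<kappa> * (R - 2)"
    using assms R unfolding inner_zone_def by linarith
  then have "norm (x - q) \<le> R - 2" using kappa by simp
  moreover have "norm (y - q) \<le> norm (y - x) + norm (x - q)"
    using norm_triangle_ineq[of "y - x" "x - q"] by simp
  ultimately have "norm (y - q) \<le> R" using assms by linarith
  then have "norm (y - q) / R \<le> 1" using R by simp
  then show ?thesis unfolding cutoff_def by simp
qed

text \<open>Over the thickness of the slab the slope costs at most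
  \<open>\<delta> * (b - \<beta>)\<close>, and the zigzag costs at most \<open>a * K\<close>;
  together this is at most \<open>\<epsilon>\<close>.\<close>

lemma height_bounds:
  assumes "x \<in> L" "zone x"
  shows "c - \<epsilon> \<le> height x" "height x \<le> c"
proof -
  have "a * col x \<le> a * K" "0 \<le> a * col x" using col_le col_nonneg assms delta by auto
  moreover have "\<delta> * (\<beta> - b) \<le> \<delta> * (N \<bullet> x - b)" "\<delta> * (N \<bullet> x - b) \<le> 0"
    using assms delta unfolding zone_def by (auto simp: mult_le_0_iff)
  moreover have "\<delta> * (\<beta> - b) = - (\<delta> * (b - \<beta>))" by (simp add: algebra_simps)
  ultimately show "c - \<epsilon> \<le> height x" "height x \<le> c"
    using delta(3) c_eps(4) unfolding height_def by auto
qed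

lemma side_cases: "side x \<in> {\<sigma>, \<sigma> + \<tau>}" unfolding side_def by auto

lemma norm_shift_zone:
  assumes "x \<in> L" "zone x"
  shows "norm (shift x) \<le> c * norm N + norm \<sigma> + norm \<tau>"
proof -
  have "shift x = height x *\<^sub>R N + cutoff x *\<^sub>R side x" using assms unfolding shift_def by simp
  then have "norm (shift x) \<le> norm (height x *\<^sub>R N) + norm (cutoff x *\<^sub>R side x)"
    by (simp only: norm_triangle_ineq)
  moreover have "norm (height x *\<^sub>R N) \<le> c * norm N"
    using height_bounds[OF assms] c_eps by (auto intro!: mult_right_mono)
  moreover have "norm (cutoff x *\<^sub>R side x) \<le> norm (side x)"
    using cutoff_bounds[of x] by (simp add: mult_left_le_one_le)
  moreover have "norm (side x) \<le> norm \<sigma> + norm \<tau>"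
    unfolding side_def using norm_triangle_ineq[of \<sigma> \<tau>] by simp
  ultimately show ?thesis by linarith
qed

lemma norm_shift: "x \<in> L \<Longrightarrow> norm (shift x) \<le> W"
proof (cases "zone x")
  case True
  assume "x \<in> L"
  then show ?thesis using norm_shift_zone[of x] True W norm_ge_zero[of t] by linarith
next
  case False
  have "0 \<le> c * norm N" using c_eps by (intro mult_nonneg_nonneg) auto
  then have "norm t \<le> W" using W norm_ge_zero[of \<sigma>] norm_ge_zero[of \<tau>] by linarith
  then show ?thesis using False W_nonneg unfolding shift_def by simp
qed

section \<open>Separation of displaced pairs, by the position of the two points\<close>

text \<open>The step raises \<open>N \<bullet> x\<close> by at least \<open>\<nu>\<close>, while the
  cone term grows by at most \<open>2 * \<kappa> \<le> \<nu>\<close>.\<close>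

lemma zone_up:
  assumes "zone x" "x \<in> L" "y \<in> L" "norm (y - x) = 2" "0 < N \<bullet> (y - x)" "N \<bullet> y < b"
  shows "zone y"
proof -
  have "\<nu> \<le> N \<bullet> (y - x)" using assms nu diff_mem by blast
  moreover have "norm (y - q) \<le> norm (x - q) + 2"
    using norm_triangle_ineq[of "y - x" "x - q"] assms by simp
  then have "\<kappa> * norm (y - q) \<le> \<kappa> * norm (x - q) + 2 * \<kappa>"
    using kappa mult_left_mono[of "norm (y - q)" "norm (x - q) + 2" \<kappa>] by (simp add: algebra_simps)
  ultimately show ?thesis using assms kappa nu unfolding zone_def by (simp add: inner_diff_right)
qed

lemma inner_zone_up:
  assumes "inner_zone x" "x \<in> L" "y \<in> L" "norm (y - x) = 2" "0 < N \<bullet> (y - x)" "N \<bullet> y < b"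
  shows "inner_zone y"
proof -
  have "\<nu> \<le> N \<bullet> (y - x)" using assms nu diff_mem by blast
  moreover have "norm (y - q) \<le> norm (x - q) + 2"
    using norm_triangle_ineq[of "y - x" "x - q"] assms by simp
  then have "\<kappa> * norm (y - q) \<le> \<kappa> * norm (x - q) + 2 * \<kappa>"
    using kappa mult_left_mono[of "norm (y - q)" "norm (x - q) + 2" \<kappa>] by (simp add: algebra_simps)
  ultimately show ?thesis using assms kappa nu unfolding inner_zone_def by (simp add: inner_diff_right)
qed

text \<open>If the cutoff at \<open>y\<close> is positive, the lateral boundary of the zone is out
  of reach, so \<open>x\<close> lies below the bottom of the slab and \<open>adm_low\<close>
  applies. Otherwise \<open>y\<close> moves along \<open>N\<close> only, and on a shortest bond
  \<open>x\<close> cannot be the higher end by \<open>zone_up\<close>.\<close>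

lemma low_zone:
  assumes "x \<in> L" "y \<in> L" "x \<noteq> y" "\<not> zone x" "N \<bullet> x < b" "zone y"
    and C: "norm (y - x) < 2 + 2 * W"
  shows "2 \<le> norm (y - x + shift y)"
proof (cases "0 < cutoff y")
  case True
  have "norm (x - q) \<le> 2 * R + (2 + 2 * W)"
    using cutoff_pos_imp[OF True] C norm_triangle_ineq[of "x - y" "y - q"]
    by (simp add: norm_minus_commute)
  then have "\<kappa> * norm (x - q) \<le> \<kappa> * (2 * R + (2 + 2 * W))" using kappa by simp
  then have "N \<bullet> x < \<beta>" using assms unfolding zone_def by auto
  then have "0 < N \<bullet> (y - x)" using assms unfolding zone_def by (simp add: inner_diff_right)
  then show ?thesis
    using adm_low[OF diff_mem _ cutoff_bounds height_bounds side_cases, of y x y y y] assms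
    unfolding shift_def by simp
next
  case False
  then have s: "shift y = height y *\<^sub>R N" using assms cutoff_bounds[of y] unfolding shift_def by simp
  have h: "0 \<le> height y" "height y \<le> c" using height_bounds[of y] assms c_eps by auto
  have "y - x \<in> L" "y - x \<noteq> 0" using assms diff_mem by auto
  then consider "norm (y - x) = 2" | "14/5 \<le> norm (y - x)" using norm_cases by blast
  then show ?thesis
  proof cases
    case 1
    have "0 \<le> N \<bullet> (y - x)"
    proof (rule ccontr)
      assume "\<not> 0 \<le> N \<bullet> (y - x)"
      then have "0 < N \<bullet> (x - y)" by (simp add: inner_diff_right)
      then have "zone x" using 1 assms zone_up[of y x] by (simp add: norm_minus_commute)
      then show False using assms by blast
    qed
    then show ?thesis unfolding s using 1 h
      by (intro two_le_norm_add_inner) (auto simp: inner_commute)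
  next
    case 2
    \<comment> \<open>A longer bond loses at most 4/5 of its length 14/5.\<close>
    have "norm (height y *\<^sub>R N) \<le> c * norm N" using h by (auto intro!: mult_right_mono)
    then show ?thesis unfolding s using 2 c_eps norm_diff_ineq[of "y - x" "height y *\<^sub>R N"] by linarith
  qed
qed

lemma zone_high:
  assumes "x \<in> L" "y \<in> L" "zone x" "\<not> N \<bullet> y < b"
  shows "2 \<le> norm (y - x + (t - shift x))"
proof -
  have "0 < N \<bullet> (y - x)" using assms unfolding zone_def by (simp add: inner_diff_right)
  then show ?thesis
    using adm_high[OF diff_mem _ cutoff_bounds height_bounds side_cases, of y x x x x] assms
    unfolding shift_def by simp
qed

text \<open>An error of size \<open>\<mu>\<close> from the decay of the cutoff is absent in the first case, compensated in
  first order in the second, and in second order, by the zigzag, in the third.\<close>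

lemma height_diff:
  assumes "x \<in> L" "y \<in> L" "zone x" "zone y" "norm (y - x) = 2"
  shows "(cutoff x = 1 \<and> cutoff y = 1 \<and> 0 \<le> (height y - height x) * (N \<bullet> (y - x))) \<or>
    2 * \<mu> \<le> (height y - height x) * (N \<bullet> (y - x)) \<or>
    (N \<bullet> (y - x) = 0 \<and> a \<le> \<bar>height y - height x\<bar>)"
proof (cases "inner_zone x \<or> inner_zone y")
  case True
  have cut: "cutoff x = 1" "cutoff y = 1"
    using True cutoff_near_inner_zone[of x x] cutoff_near_inner_zone[of x y]
      cutoff_near_inner_zone[of y x] cutoff_near_inner_zone[of y y] assms
    by (auto simp: norm_minus_commute)
  \<comment> \<open>The upper end of a rising bond is displaced at least as much: either it is in
    the inner zone and has the largest height, or both ends are outside and the slope beats the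
    zigzag.\<close>
  have up: "0 \<le> height v - height u"
    if "u \<in> L" "v \<in> L" "zone u" "zone v" "norm (v - u) = 2" "0 < N \<bullet> (v - u)" for u v
  proof (cases "inner_zone v")
    case True
    then show ?thesis using height_bounds(2)[of u] that by (simp add: height_def)
  next
    case False
    then have "\<not> inner_zone u" using inner_zone_up that unfolding zone_def by blast
    moreover have "N \<bullet> (v - u) \<ge> \<nu>" using nu that diff_mem by blast
    then have "\<delta> * \<nu> \<le> \<delta> * (N \<bullet> (v - u))" using delta by simp
    moreover have "a * col v \<le> a * K" "0 \<le> a * col u" using col_le col_nonneg that delta by auto
    moreover have "0 < \<delta> * \<nu>" using delta nu by simp
    ultimately show ?thesis using False delta(4)
      by (simp add: height_def inner_diff_right algebra_simps)
  qed
  have "0 \<le> (height y - height x) * (N \<bullet> (y - x))"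
  proof (cases "N \<bullet> (y - x)" "0 :: real" rule: linorder_cases)
    case less
    then have "0 \<le> height x - height y"
      using up[of y x] assms by (simp add: norm_minus_commute inner_diff_right)
    then show ?thesis using less by (simp add: mult_nonpos_nonpos)
  next
    case greater
    then show ?thesis using up[of x y] assms by simp
  qed simp
  then show ?thesis using cut by blast
next
  case False
  \<comment> \<open>The slope gains at least \<open>\<delta> * \<nu>\<close> along the bond, and the
    zigzag takes back at most half of it.\<close>
  have key: "2 * \<mu> \<le> (height v - height u) * (N \<bullet> (v - u))"
    if "u \<in> L" "v \<in> L" "\<not> inner_zone u" "\<not> inner_zone v" "norm (v - u) = 2" "0 < N \<bullet> (v - u)" for u v
  proof -
    have n: "N \<bullet> (v - u) \<ge> \<nu>" using nu that diff_mem by blast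
    then have "\<delta> * \<nu> \<le> \<delta> * (N \<bullet> (v - u))" using delta by simp
    moreover have "a * col v \<le> a * K" "0 \<le> a * col u" using col_le col_nonneg that delta by auto
    ultimately have "\<delta> * \<nu> / 2 \<le> height v - height u" using that delta(4)
      by (simp add: height_def inner_diff_right algebra_simps)
    then have "(\<delta> * \<nu> / 2) * \<nu> \<le> (height v - height u) * (N \<bullet> (v - u))"
      using n nu(1) delta(1) \<open>\<delta> * \<nu> / 2 \<le> _\<close> mult_pos_pos[OF delta(1) nu(1)]
      by (intro mult_mono) linarith+
    then show ?thesis using mu(3) by (simp add: power2_eq_square)
  qed
  show ?thesis
  proof (cases "N \<bullet> (y - x)" "0 :: real" rule: linorder_cases)
    case less
    then have "2 * \<mu> \<le> (height x - height y) * (N \<bullet> (x - y))"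
      using key[of y x] assms False by (simp add: norm_minus_commute inner_diff_right)
    then show ?thesis by (simp add: inner_diff_right algebra_simps)
  next
    case greater
    then show ?thesis using key[of x y] assms False by blast
  next
    case equal
    \<comment> \<open>On a horizontal bond the slope cancels and only the colours remain.\<close>
    then have "height y - height x = a * (col x - col y)"
      using False by (simp add: height_def inner_diff_right algebra_simps)
    moreover have "1 \<le> \<bar>col x - col y\<bar>" using assms col_diff[of x y] by (simp add: norm_minus_commute)
    ultimately have "a \<le> \<bar>height y - height x\<bar>"
      using delta by (simp add: abs_mult)
    then show ?thesis using equal by blast
  qed
qed

text \<open>The relative displacement consists of a height difference, the opening \<open>T\<close>
  of the cut scaled by the cutoff, and the decay error \<open>s\<close>. On a shortest bond the
  first two do no harm to first order; the point is to pay for \<open>s\<close>.\<close>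

lemma zone_zone:
  assumes "x \<in> L" "y \<in> L" "x \<noteq> y" "zone x" "zone y"
    and C: "norm (y - x) < 2 + 2 * W"
    and cut: "side y = side x \<or> 0 < N' \<bullet> (y - x) \<and> side y = side x + \<tau>"
  shows "2 \<le> norm (y - x + (shift y - shift x))"
proof -
  define e where "e = y - x"
  define \<eta> where "\<eta> = height y - height x"
  define T where "T = side y - side x"
  define f where "f = cutoff y"
  define s where "s = (cutoff y - cutoff x) *\<^sub>R side x"
  have D: "shift y - shift x = \<eta> *\<^sub>R N + f *\<^sub>R T + s"
    unfolding shift_def \<eta>_def T_def f_def s_def using assms by (simp add: algebra_simps)
  have f: "0 \<le> f" "f \<le> 1" unfolding f_def by (rule cutoff_bounds)+
  have e: "e \<in> L" "e \<noteq> 0" unfolding e_def using assms diff_mem by auto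
  have "norm s \<le> (2 + 2 * W) / R * (norm \<sigma> + norm \<tau>)"
  proof -
    have "norm s = \<bar>cutoff y - cutoff x\<bar> * norm (side x)" unfolding s_def by simp
    also have "\<dots> \<le> ((2 + 2 * W) / R) * (norm \<sigma> + norm \<tau>)"
    proof (rule mult_mono)
      have "norm (y - x) / R \<le> (2 + 2 * W) / R" using C R by (intro divide_right_mono) auto
      then show "\<bar>cutoff y - cutoff x\<bar> \<le> (2 + 2 * W) / R" using cutoff_diff[of y x] by linarith
      show "norm (side x) \<le> norm \<sigma> + norm \<tau>"
        unfolding side_def using norm_triangle_ineq[of \<sigma> \<tau>] by simp
    qed (use R W_nonneg in auto)
    finally show ?thesis .
  qed
  then have s: "norm s \<le> \<mu>" using R by linarith
  have T: "T = 0 \<or> T = \<tau> \<and> 0 < N' \<bullet> e" unfolding T_def e_def using cut by auto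
  consider "norm e \<noteq> 2" | "norm e = 2" by blast
  then have "2 \<le> norm (e + (\<eta> *\<^sub>R N + f *\<^sub>R T + s))"
  proof cases
    case 1
    then have far: "14/5 \<le> norm e" using norm_cases e by blast
    have "\<bar>\<eta>\<bar> \<le> \<epsilon>" unfolding \<eta>_def using height_bounds[of x] height_bounds[of y] assms by auto
    then have "\<bar>\<eta>\<bar> * norm N \<le> \<epsilon> * norm N" by (intro mult_right_mono) auto
    then have n: "norm (\<eta> *\<^sub>R N) \<le> 1/10" using c_eps by simp
    \<comment> \<open>The length 9/4 absorbs an error of 1/10 from the heights and another 1/10 from
      the decay.\<close>
    have "9/4 \<le> norm (e + f *\<^sub>R T)"
      using T far tau_far[of e f] e f 1 by auto
    moreover have "norm (\<eta> *\<^sub>R N + s) \<le> 1/5" using n s mu norm_triangle_ineq[of "\<eta> *\<^sub>R N" s] by linarith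
    ultimately have "2 \<le> norm ((e + f *\<^sub>R T) + (\<eta> *\<^sub>R N + s))"
      using norm_diff_ineq[of "e + f *\<^sub>R T" "\<eta> *\<^sub>R N + s"] by linarith
    then show ?thesis by (simp add: algebra_simps)
  next
    case 2
    have es: "- 2 * \<mu> \<le> e \<bullet> s"
    proof -
      have "\<bar>e \<bullet> s\<bar> \<le> norm e * norm s" by (rule Cauchy_Schwarz_ineq2)
      then show ?thesis using 2 s by auto
    qed
    have eT: "0 \<le> e \<bullet> T" using T tau_min e 2 by force
    have eD: "e \<bullet> (\<eta> *\<^sub>R N + f *\<^sub>R T + s) = \<eta> * (N \<bullet> e) + f * (e \<bullet> T) + e \<bullet> s"
      by (simp add: inner_add_right inner_commute)
    have fT: "0 \<le> f * (e \<bullet> T)" using f eT by simp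
    consider (flat) "cutoff x = 1" "cutoff y = 1" "0 \<le> \<eta> * (N \<bullet> e)"
      | (up) "2 * \<mu> \<le> \<eta> * (N \<bullet> e)" | (hor) "N \<bullet> e = 0" "a \<le> \<bar>\<eta>\<bar>"
      using height_diff[of x y] assms 2 unfolding \<eta>_def e_def by blast
    then show ?thesis
    proof cases
      case flat
      then have "s = 0" unfolding s_def by simp
      then show ?thesis using flat fT eD 2 by (intro two_le_norm_add_inner) auto
    next
      case up
      then show ?thesis using fT eD es 2 by (intro two_le_norm_add_inner) auto
    next
      case hor
      \<comment> \<open>Either the opening of the cut pays for the decay to first order, or
        \<open>f\<close> is so small that the zigzag dominates the displacement, whose squared norm
        then exceeds \<open>4 * \<mu>\<close>.\<close>
      show ?thesis
      proof (cases "2 * \<mu> \<le> f * (e \<bullet> T)")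
        case True
        then show ?thesis using hor eD es 2 by (intro two_le_norm_add_inner) auto
      next
        case False
        have "norm (f *\<^sub>R T) + \<mu> \<le> a * norm N / 2"
        proof (cases "T = 0")
          case True
          have "\<mu> * \<kappa>' \<le> \<mu> * (\<kappa>' + 2 * norm \<tau>)" using mu by (intro mult_left_mono) auto
          then have "\<kappa>' * \<mu> \<le> \<kappa>' * (a * norm N / 2)" using mu by (simp add: mult.commute)
          then have "\<mu> \<le> a * norm N / 2" using tau_min(1) mult_le_cancel_left_pos by blast
          then show ?thesis using True by simp
        next
          case nz: False
          then have T\<tau>: "T = \<tau>" "0 < N' \<bullet> e" using T by auto
          have "f * \<kappa>' \<le> f * (e \<bullet> T)" using T\<tau> tau_min(2) e 2 f by (intro mult_left_mono) auto
          then have "f * \<kappa>' \<le> 2 * \<mu>" using False by linarith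
          then have "f * \<kappa>' * norm \<tau> \<le> 2 * \<mu> * norm \<tau>" by (intro mult_right_mono) auto
          then have "\<kappa>' * (f * norm \<tau> + \<mu>) \<le> \<kappa>' * (a * norm N / 2)"
            using mu(5) by (simp add: algebra_simps)
          then have "f * norm \<tau> + \<mu> \<le> a * norm N / 2" using tau_min(1) mult_le_cancel_left_pos by blast
          then show ?thesis using T\<tau> f by simp
        qed
        moreover have "a * norm N \<le> norm (\<eta> *\<^sub>R N)" using hor by (simp add: mult_right_mono)
        moreover have "norm (f *\<^sub>R T + s) \<le> norm (f *\<^sub>R T) + \<mu>"
          using s norm_triangle_ineq[of "f *\<^sub>R T" s] by linarith
        moreover have "norm (\<eta> *\<^sub>R N) - norm (f *\<^sub>R T + s) \<le> norm (\<eta> *\<^sub>R N + (f *\<^sub>R T + s))"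
          by (rule norm_diff_ineq)
        ultimately have "a * norm N / 2 \<le> norm (\<eta> *\<^sub>R N + f *\<^sub>R T + s)" by (simp add: add.assoc)
        then have "(a * norm N / 2)\<^sup>2 \<le> (norm (\<eta> *\<^sub>R N + f *\<^sub>R T + s))\<^sup>2"
          using delta by (intro power_mono) auto
        moreover have "4 * \<mu> \<le> (a * norm N / 2)\<^sup>2" using mu(4) by (simp add: power_divide)
        ultimately show ?thesis using hor eD es fT 2 by (intro two_le_norm_add) auto
      qed
    qed
  qed
  then show ?thesis unfolding D e_def .
qed

text \<open>Every shift has norm at most \<open>W\<close>, so only pairs closer than
  \<open>2 + 2 * W\<close> need an argument.\<close>

lemma shift_separates:
  assumes "x \<in> L" "y \<in> L" "x \<noteq> y"
  shows "2 \<le> dist (x + shift x) (y + shift y)"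
proof -
  \<comment> \<open>Pairs are ordered: below the zone, in the zone, above the gap, and inside the
    zone by \<open>N'\<close>. The opposite order follows by exchanging \<open>x\<close> and
    \<open>y\<close>.\<close>
  have main: "2 \<le> norm (y - x + (shift y - shift x))"
    if "x \<in> L" "y \<in> L" "x \<noteq> y" "norm (y - x) < 2 + 2 * W"
      "zone x \<and> zone y \<and> N' \<bullet> x \<le> N' \<bullet> y \<or> \<not> zone x \<and> N \<bullet> x < b \<or> zone x \<and> \<not> N \<bullet> y < b
        \<or> \<not> N \<bullet> x < b \<and> \<not> N \<bullet> y < b" for x y
  proof -
    consider (zz) "zone x" "zone y" "N' \<bullet> x \<le> N' \<bullet> y" | (zh) "zone x" "\<not> N \<bullet> y < b"
      | (lz) "\<not> zone x" "N \<bullet> x < b" "zone y"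
      | (lh) "\<not> zone x" "N \<bullet> x < b" "\<not> zone y" "\<not> N \<bullet> y < b"
      | (triv) "\<not> zone x" "N \<bullet> x < b" "\<not> zone y" "N \<bullet> y < b" | (triv') "\<not> N \<bullet> x < b" "\<not> N \<bullet> y < b"
      using \<open>_ \<or> _\<close> by blast
    then show ?thesis
    proof cases
      case zz
      then have "side y = side x \<or> 0 < N' \<bullet> (y - x) \<and> side y = side x + \<tau>"
        unfolding side_def by (auto simp: inner_diff_right)
      then show ?thesis using zone_zone that zz by blast
    next
      case zh
      then have "\<not> zone y" unfolding zone_def by blast
      then have "shift y = t" using zh unfolding shift_def by simp
      then show ?thesis using zone_high that zh by simp
    next
      case lz
      then have "shift x = 0" unfolding shift_def by simp
      then show ?thesis using low_zone[of x y] that lz by simp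
    next
      case lh
      then have "shift x = 0" "shift y = t" unfolding shift_def by auto
      moreover have "0 < N \<bullet> (y - x)" using lh by (simp add: inner_diff_right)
      ultimately show ?thesis using adm_t that diff_mem by simp
    next
      case triv
      then have "shift x = shift y" unfolding shift_def by simp
      then show ?thesis using two_le_norm[of "y - x"] that diff_mem by simp
    next
      case triv'
      then have "shift x = shift y" unfolding shift_def zone_def by simp
      then show ?thesis using two_le_norm[of "y - x"] that diff_mem by simp
    qed
  qed
  have eq: "dist (x + shift x) (y + shift y) = norm (y - x + (shift y - shift x))"
    "dist (x + shift x) (y + shift y) = norm (x - y + (shift x - shift y))"
    unfolding dist_norm by (metis add_diff_add norm_minus_commute, simp add: algebra_simps)
  show ?thesis
  proof (cases "norm (y - x) < 2 + 2 * W")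
    case True
    moreover have "norm (x - y) < 2 + 2 * W" using True by (simp add: norm_minus_commute)
    moreover have "zone u \<Longrightarrow> N \<bullet> u < b" for u unfolding zone_def by simp
    ultimately show ?thesis
      using main[of x y] main[of y x] assms eq linear[of "N' \<bullet> x" "N' \<bullet> y"]
      by (smt (verit))
  next
    case False
    moreover have "norm (shift y - shift x) \<le> 2 * W"
      using norm_triangle_ineq4[of "shift y" "shift x"] norm_shift assms by (smt (verit))
    ultimately show ?thesis
      unfolding eq using norm_diff_ineq[of "y - x" "shift y - shift x"] by linarith
  qed
qed

end

section \<open>The displaced packing and its patch of the new gap\<close>

context gap_shift
begin

definition shifted where
  "shifted = (\<lambda>x. x + shift x) ` L"

lemma inj_on_shift: "inj_on (\<lambda>x. x + shift x) L"
  by (rule inj_onI) (use shift_separates in fastforce)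

lemma sphere_packing_shifted: "sphere_packing shifted"
  unfolding sphere_packing_iff_dist shifted_def using shift_separates by blast

lemma finite_zone: "finite {x \<in> L. zone x}"
proof -
  define r where "r = (b - \<beta> + \<kappa> * (2 * R + (2 + 2 * W))) / \<kappa>"
  have "norm (x - q) \<le> r" if "zone x" for x
    using that kappa unfolding zone_def r_def by (simp add: field_simps)
  then have "{x \<in> L. zone x} \<subseteq> L \<inter> cball q r"
    by (auto simp: dist_norm norm_minus_commute)
  then show ?thesis using finite_bounded[of "cball q r"] finite_subset by blast
qed

text \<open>The two packings differ only in the finitely many balls of the zone, so
  \<open>improvable_exchange\<close> applies.\<close>

lemma improvable_if_shifted:
  assumes "improvable shifted"
  shows "improvable (gap N b t)"
proof -
  define Z where "Z = {x \<in> L. zone x}"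
  define F where "F = (\<lambda>x. x + shift x) ` Z"
  define S where "S = (\<lambda>x. x + shift x) ` (L - Z)"
  have ZL: "Z \<subseteq> L" unfolding Z_def by blast
  have fin: "finite Z" unfolding Z_def by (rule finite_zone)
  have split: "shifted = S \<union> F" unfolding shifted_def S_def F_def using ZL by blast
  have "gap N b t = (\<lambda>x. if N \<bullet> x < b then x else x + t) ` (L - Z)
      \<union> (\<lambda>x. if N \<bullet> x < b then x else x + t) ` Z"
    unfolding gap_def using ZL by blast
  also have "(\<lambda>x. if N \<bullet> x < b then x else x + t) ` (L - Z) = S"
    unfolding S_def shift_def Z_def by (intro image_cong) auto
  also have "(\<lambda>x. if N \<bullet> x < b then x else x + t) ` Z = (\<lambda>x. x) ` Z"
    unfolding Z_def zone_def by (intro image_cong) auto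
  finally have gap: "gap N b t = S \<union> Z" by simp
  \<comment> \<open>An unmoved point outside the zone is not in \<open>Z\<close>, and a point
    \<open>x + t\<close> from above the gap that fell into \<open>Z\<close> would violate
    \<open>adm_t\<close>.\<close>
  have "S \<inter> Z = {}"
  proof (intro equals0I, elim IntE)
    fix p assume "p \<in> S" "p \<in> Z"
    then obtain x where x: "x \<in> L" "\<not> zone x" "p = x + shift x" unfolding S_def Z_def by blast
    have p: "p \<in> L" "zone p" using \<open>p \<in> Z\<close> unfolding Z_def by auto
    have "\<not> N \<bullet> x < b" using x p unfolding shift_def by auto
    moreover have "N \<bullet> p < b" using p unfolding zone_def by blast
    ultimately have "0 < N \<bullet> (x - p)" "p = x + t"
      using x unfolding shift_def by (simp_all only: inner_diff_right) auto
    then have "2 \<le> norm (x - p + t)" using adm_t[OF diff_mem[OF x(1) p(1)]] by blast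
    then show False using \<open>p = x + t\<close> by simp
  qed
  moreover have "S \<inter> F = {}"
    unfolding S_def F_def using inj_on_image_Int[OF inj_on_shift, of "L - Z" Z] ZL by auto
  moreover have "card Z = card F"
    unfolding F_def using inj_on_shift ZL by (metis card_image inj_on_subset)
  ultimately show ?thesis
    unfolding gap using assms fin improvable_exchange[of S F Z] unfolding split F_def by auto
qed

lemma shift_inner_zone: "inner_zone x \<Longrightarrow> shift x = c *\<^sub>R N + side x"
  unfolding shift_def using inner_zone_imp_zone cutoff_near_inner_zone[of x x]
  by (simp add: height_def)

text \<open>On the inner zone the field is one translation, plus \<open>\<tau>\<close> beyond the
  cut. Since \<open>L\<close> is invariant under translation by \<open>q\<close>, this reproduces
  the new gap around \<open>\<zeta>\<close>; the margin \<open>2 * W\<close> allows for the distance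
  between a displaced point and its origin.\<close>

lemma shifted_patch:
  assumes q: "q \<in> L" and b': "b' = b0 + N' \<bullet> q" and \<zeta>: "\<zeta> = q + c *\<^sub>R N + \<sigma>"
    and near: "\<And>x. x \<in> L \<Longrightarrow> norm (x - q) < \<rho> + 2 * W \<Longrightarrow> inner_zone x"
    and p: "norm (p - \<zeta>) < \<rho>"
  shows "p \<in> shifted \<longleftrightarrow> p - \<zeta> \<in> gap N' b0 \<tau>"
proof -
  have "0 \<le> c * norm N" "norm (c *\<^sub>R N) = c * norm N" using c_eps by auto
  then have W': "norm (c *\<^sub>R N + \<sigma>) \<le> W" "norm \<tau> \<le> W"
    using W norm_triangle_ineq[of "c *\<^sub>R N" \<sigma>] norm_ge_zero[of t] norm_ge_zero[of \<tau>]
      norm_ge_zero[of \<sigma>] by linarith+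
  have pos: "x + shift x - \<zeta> = (if N' \<bullet> (x - q) < b0 then x - q else x - q + \<tau>)"
    if "x \<in> L" "norm (x - q) < \<rho> + 2 * W" for x
  proof -
    have "N' \<bullet> x < b' \<longleftrightarrow> N' \<bullet> (x - q) < b0" unfolding b' by (auto simp: inner_diff_right)
    then show ?thesis using shift_inner_zone[OF near[OF that]] unfolding side_def \<zeta> by simp
  qed
  show ?thesis
  proof
    assume "p \<in> shifted"
    then obtain x where x: "x \<in> L" "p = x + shift x" unfolding shifted_def by blast
    have "x - q = (p - \<zeta>) + (c *\<^sub>R N + \<sigma>) - shift x" unfolding x \<zeta> by simp
    then have "norm (x - q) = norm ((p - \<zeta>) + (c *\<^sub>R N + \<sigma>) - shift x)" by (rule arg_cong)
    then have "norm (x - q) \<le> norm (p - \<zeta>) + norm (c *\<^sub>R N + \<sigma>) + norm (shift x)"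
      using norm_triangle_ineq4[of "(p - \<zeta>) + (c *\<^sub>R N + \<sigma>)" "shift x"]
        norm_triangle_ineq[of "p - \<zeta>" "c *\<^sub>R N + \<sigma>"] by linarith
    then have "norm (x - q) < \<rho> + 2 * W" using p W' norm_shift[OF x(1)] by linarith
    then have "p - \<zeta> = (if N' \<bullet> (x - q) < b0 then x - q else x - q + \<tau>)"
      using pos x by blast
    then show "p - \<zeta> \<in> gap N' b0 \<tau>"
      unfolding gap_def using diff_mem[OF x(1) q] by (rule image_eqI)
  next
    assume "p - \<zeta> \<in> gap N' b0 \<tau>"
    then obtain y where y: "y \<in> L" "p - \<zeta> = (if N' \<bullet> y < b0 then y else y + \<tau>)"
      unfolding gap_def by blast
    have "norm y \<le> norm (p - \<zeta>) + norm \<tau>"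
      unfolding y(2) using norm_triangle_ineq4[of "y + \<tau>" \<tau>] by auto
    then have "norm (y + q - q) < \<rho> + 2 * W" using p W' W_nonneg by simp
    then have "(y + q) + shift (y + q) - \<zeta> = p - \<zeta>" using pos[of "y + q"] y q add_mem by simp
    then have "p = (y + q) + shift (y + q)" by simp
    then show "p \<in> shifted" unfolding shifted_def using add_mem[OF y(1) q] by (rule image_eqI)
  qed
qed

end

section \<open>Transfer of improvability from one gap to another\<close>

context colored_lattice
begin

lemma scale_mem: "x \<in> L \<Longrightarrow> real k *\<^sub>R x \<in> L"
  by (induction k) (auto simp: zero_mem add_mem scaleR_add_left)

text \<open>The constants are fixed in the order radius of the witness, bottom of the slab, slope,
  zigzag, admissible error \<open>\<mu>\<close>, and finally \<open>R\<close>. There is no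
  circularity, since \<open>R\<close> affects the lateral extent of the slab but not its
  thickness.\<close>

lemma improvable_gap_transfer:
  assumes imp: "improvable (gap N' b0 \<tau>)"
    and span: "x0 \<in> L" "N \<bullet> x0 \<noteq> 0"
    and adm_t: "\<And>e. e \<in> L \<Longrightarrow> 0 < N \<bullet> e \<Longrightarrow> 2 \<le> norm (e + t)"
    and adm_low: "\<And>e z f s. e \<in> L \<Longrightarrow> 0 < N \<bullet> e \<Longrightarrow> 0 \<le> f \<Longrightarrow> f \<le> 1 \<Longrightarrow> c - \<epsilon> \<le> z \<Longrightarrow> z \<le> c \<Longrightarrow>
      s \<in> {\<sigma>, \<sigma> + \<tau>} \<Longrightarrow> 2 \<le> norm (e + (z *\<^sub>R N + f *\<^sub>R s))"
    and adm_high: "\<And>e z f s. e \<in> L \<Longrightarrow> 0 < N \<bullet> e \<Longrightarrow> 0 \<le> f \<Longrightarrow> f \<le> 1 \<Longrightarrow> c - \<epsilon> \<le> z \<Longrightarrow> z \<le> c \<Longrightarrow>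
      s \<in> {\<sigma>, \<sigma> + \<tau>} \<Longrightarrow> 2 \<le> norm (e + (t - (z *\<^sub>R N + f *\<^sub>R s)))"
    and c: "0 < \<epsilon>" "\<epsilon> \<le> c" "c * norm N \<le> 4/5"
    and tau_min: "\<And>e. e \<in> L \<Longrightarrow> norm e = 2 \<Longrightarrow> 0 < N' \<bullet> e \<Longrightarrow> 0 < e \<bullet> \<tau>"
    and tau_far: "\<And>e f. e \<in> L \<Longrightarrow> norm e \<noteq> 2 \<Longrightarrow> 0 < N' \<bullet> e \<Longrightarrow> 0 \<le> f \<Longrightarrow> f \<le> 1 \<Longrightarrow>
      9/4 \<le> norm (e + f *\<^sub>R \<tau>)"
  shows "improvable (gap N b t)"
proof -
  have N: "0 < norm N" using span by auto
  obtain \<nu> where \<nu>: "\<nu> > 0" "\<And>e. e \<in> L \<Longrightarrow> norm e = 2 \<Longrightarrow> 0 < N \<bullet> e \<Longrightarrow> \<nu> \<le> N \<bullet> e"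
    using min_inner by blast
  \<comment> \<open>Here \<open>min_inner\<close> is applied to \<open>\<tau>\<close> in place of a
    normal; by \<open>tau_min\<close> it covers the bonds that cross the cut.\<close>
  obtain \<kappa>' where \<kappa>': "\<kappa>' > 0" "\<And>e. e \<in> L \<Longrightarrow> norm e = 2 \<Longrightarrow> 0 < \<tau> \<bullet> e \<Longrightarrow> \<kappa>' \<le> \<tau> \<bullet> e"
    using min_inner by blast
  define \<kappa> where "\<kappa> = \<nu> / 2"
  define \<epsilon>' where "\<epsilon>' = min \<epsilon> (1 / (10 * norm N))"
  define W where "W = norm t + c * norm N + norm \<sigma> + norm \<tau>"
  have W: "0 \<le> W" unfolding W_def using c by simp
  have K: "0 \<le> K" using col_nonneg col_le zero_mem by force
  obtain \<rho> where \<rho>: "\<rho> > 0" "\<And>X \<zeta>. sphere_packing X \<Longrightarrow>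
      (\<And>p. norm (p - \<zeta>) < \<rho> \<Longrightarrow> p \<in> X \<longleftrightarrow> p - \<zeta> \<in> gap N' b0 \<tau>) \<Longrightarrow> improvable X"
    using improvable_local[OF imp] by blast
  define r where "r = \<rho> + 2 * W"
  have r: "0 < r" unfolding r_def using \<rho> W by simp
  obtain x1 where x1: "x1 \<in> L" "0 < N \<bullet> x1"
    using span uminus_mem[of x0] by (cases "0 < N \<bullet> x0") auto
  obtain k :: nat where k: "norm N * r - b < k * (N \<bullet> x1)"
    using reals_Archimedean3[OF x1(2)] by blast
  \<comment> \<open>\<open>q\<close> is so deep that the ball of radius \<open>r\<close> around it
    stays below the gap.\<close>
  define q where "q = - (real k *\<^sub>R x1)"
  have q: "q \<in> L" unfolding q_def using x1 scale_mem uminus_mem by blast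
  have Nq: "N \<bullet> q + norm N * r < b" using k unfolding q_def by simp
  \<comment> \<open>The bottom is low enough for this ball to lie in the inner zone.\<close>
  define \<beta> where "\<beta> = N \<bullet> q - (norm N + \<kappa>) * r"
  have "0 < \<kappa>" unfolding \<kappa>_def using \<nu> by simp
  have "0 \<le> norm N * r" "0 < \<kappa> * r" using r \<open>0 < \<kappa>\<close> by simp_all
  then have b\<beta>: "0 < b - \<beta>" using Nq unfolding \<beta>_def by (simp add: algebra_simps)
  have \<epsilon>': "0 < \<epsilon>'" unfolding \<epsilon>'_def using c N by simp
  have \<epsilon>'N: "\<epsilon>' * norm N \<le> 1/10"
  proof -
    have "\<epsilon>' * norm N \<le> (1 / (10 * norm N)) * norm N"
      unfolding \<epsilon>'_def using N by (intro mult_right_mono) auto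
    then show ?thesis using N by simp
  qed
  \<comment> \<open>The slope uses up one half of \<open>\<epsilon>'\<close>; the other half is
    reserved for the zigzag.\<close>
  define \<delta> where "\<delta> = \<epsilon>' / 2 / (b - \<beta>)"
  have "0 < \<delta>" unfolding \<delta>_def using b\<beta> \<epsilon>' by simp
  moreover have "\<delta> * (b - \<beta>) = \<epsilon>' / 2"
    using b\<beta> nonzero_eq_divide_eq[of "b - \<beta>" \<delta> "\<epsilon>' / 2"] unfolding \<delta>_def by simp
  ultimately have \<delta>: "0 < \<delta>" "\<delta> * (b - \<beta>) = \<epsilon>' / 2" .
  \<comment> \<open>The denominator has \<open>K + 1\<close> in place of \<open>K\<close> to stay
    positive when \<open>K = 0\<close>.\<close>
  define a where "a = min \<epsilon>' (\<delta> * \<nu>) / (2 * (K + 1))"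
  have m: "0 < min \<epsilon>' (\<delta> * \<nu>)" using \<epsilon>' \<delta> \<nu> by simp
  then have a: "0 < a" unfolding a_def using K by simp
  have "a * K \<le> a * (K + 1)" using a by simp
  also have "\<dots> = min \<epsilon>' (\<delta> * \<nu>) / 2" unfolding a_def using K by (simp add: field_simps)
  finally have aK: "a * K \<le> \<epsilon>' / 2" "a * K \<le> \<delta> * \<nu> / 2" by auto
  define \<mu> where "\<mu> = min (min (1/10) (\<delta> * \<nu>\<^sup>2 / 4))
    (min ((a * norm N)\<^sup>2 / 16) (\<kappa>' * (a * norm N / 2) / (\<kappa>' + 2 * norm \<tau>)))"
  have den: "0 < \<kappa>' + 2 * norm \<tau>" using \<kappa>' by (simp add: add_pos_nonneg)
  have \<mu>: "0 < \<mu>" unfolding \<mu>_def using \<delta> \<nu> a N \<kappa>' den by simp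
  have \<mu>': "\<mu> \<le> 1/10" "\<mu> \<le> \<delta> * \<nu>\<^sup>2 / 4" "\<mu> \<le> (a * norm N)\<^sup>2 / 16"
    "\<mu> \<le> \<kappa>' * (a * norm N / 2) / (\<kappa>' + 2 * norm \<tau>)" unfolding \<mu>_def by linarith+
  \<comment> \<open>The first bound keeps the inner zone within the region of cutoff 1, the second
    limits the decay error to \<open>\<mu>\<close>.\<close>
  define R where "R = max (2 + (b - \<beta>) / \<kappa>) ((2 + 2 * W) * (norm \<sigma> + norm \<tau>) / \<mu>)"
  have R: "2 + (b - \<beta>) / \<kappa> \<le> R" "(2 + 2 * W) * (norm \<sigma> + norm \<tau>) / \<mu> \<le> R"
    unfolding R_def by auto
  have "0 \<le> (b - \<beta>) / \<kappa>" using b\<beta> \<open>0 < \<kappa>\<close> by simp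
  then have "0 < R" using R by linarith
  interpret gap_shift L col K N N' t \<tau> \<sigma> q b "b0 + N' \<bullet> q" \<beta> c \<epsilon>' \<delta> a \<mu> \<nu> \<kappa> \<kappa>' R W
  proof unfold_locales
    show "\<nu> \<le> N \<bullet> e" if "e \<in> L" "norm e = 2" "0 < N \<bullet> e" for e using \<nu> that by blast
    show "2 * \<kappa> \<le> \<nu>" unfolding \<kappa>_def by simp
    show "2 \<le> norm (e + (z *\<^sub>R N + f *\<^sub>R s))" if "e \<in> L" "0 < N \<bullet> e" "0 \<le> f" "f \<le> 1"
      "c - \<epsilon>' \<le> z" "z \<le> c" "s \<in> {\<sigma>, \<sigma> + \<tau>}" for e z f s
      using that by (intro adm_low) (auto simp: \<epsilon>'_def)
    show "2 \<le> norm (e + (t - (z *\<^sub>R N + f *\<^sub>R s)))" if "e \<in> L" "0 < N \<bullet> e" "0 \<le> f" "f \<le> 1"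
      "c - \<epsilon>' \<le> z" "z \<le> c" "s \<in> {\<sigma>, \<sigma> + \<tau>}" for e z f s
      using that by (intro adm_high) (auto simp: \<epsilon>'_def)
    show "0 \<le> c - \<epsilon>'" using c unfolding \<epsilon>'_def by simp
    show "\<kappa>' \<le> e \<bullet> \<tau>" if "e \<in> L" "norm e = 2" "0 < N' \<bullet> e" for e
      using \<kappa>'(2)[of e] tau_min[of e] that by (simp add: inner_commute)
    show "\<delta> * (b - \<beta>) + a * K \<le> \<epsilon>'" using \<delta> aK by simp
    show "b - \<beta> \<le> \<kappa> * (R - 2)"
    proof -
      have "(b - \<beta>) / \<kappa> \<le> R - 2" using R by linarith
      then show ?thesis using \<open>0 < \<kappa>\<close> by (simp add: divide_le_eq mult.commute)
    qed
    show "(2 + 2 * W) / R * (norm \<sigma> + norm \<tau>) \<le> \<mu>"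
      using R(2) \<open>0 < R\<close> \<mu> by (simp add: divide_le_eq mult.commute)
    show "4 * \<mu> \<le> \<delta> * \<nu>\<^sup>2" "16 * \<mu> \<le> (a * norm N)\<^sup>2" using \<mu>' by linarith+
    show "\<mu> * (\<kappa>' + 2 * norm \<tau>) \<le> \<kappa>' * (a * norm N / 2)"
      using \<mu>'(4) pos_le_divide_eq[OF den] by blast
  qed (use \<nu> \<open>0 < \<kappa>\<close> adm_t c \<epsilon>' \<epsilon>'N \<kappa>' tau_far \<delta> a aK \<open>0 < R\<close> \<mu> \<mu>' W_def in auto)
  have near: "inner_zone x" if "x \<in> L" "norm (x - q) < \<rho> + 2 * W" for x
  proof -
    have x: "norm (x - q) \<le> r" using that unfolding r_def by simp
    have "\<bar>N \<bullet> (x - q)\<bar> \<le> norm N * norm (x - q)" by (rule Cauchy_Schwarz_ineq2)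
    also have "\<dots> \<le> norm N * r" using x by (intro mult_left_mono) auto
    finally have "\<bar>N \<bullet> x - N \<bullet> q\<bar> \<le> norm N * r" by (simp add: inner_diff_right)
    moreover have "\<kappa> * norm (x - q) \<le> \<kappa> * r" using x \<open>0 < \<kappa>\<close> by simp
    ultimately have "N \<bullet> x < b" "\<beta> \<le> N \<bullet> x - \<kappa> * norm (x - q)"
      using Nq unfolding \<beta>_def distrib_right by linarith+
    then show ?thesis unfolding inner_zone_def by blast
  qed
  have "improvable shifted"
    using \<rho>(2)[OF sphere_packing_shifted] shifted_patch[OF q refl refl near] by blast
  then show ?thesis by (rule improvable_if_shifted)
qed

end

section \<open>Gaps in simplex lattices\<close>

text \<open>Sum zero forces a positive and a negative entry. Each contributes at least 1 to the sum
  of squares, so nothing is left for the others: these are the roots of the lattice A_n.\<close>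

lemma int_root_form:
  fixes m :: "nat \<Rightarrow> int"
  assumes sum: "(\<Sum>i\<le>n. m i) = 0" and sq: "(\<Sum>i\<le>n. (m i)\<^sup>2) = 2"
  obtains i j where "i \<le> n" "j \<le> n" "i \<noteq> j" "m i = 1" "m j = -1"
    "\<And>k. k \<le> n \<Longrightarrow> k \<noteq> i \<Longrightarrow> k \<noteq> j \<Longrightarrow> m k = 0"
proof -
  have nz: "\<exists>k\<le>n. m k \<noteq> 0"
  proof (rule ccontr)
    assume "\<not> (\<exists>k\<le>n. m k \<noteq> 0)"
    then have "(\<Sum>i\<le>n. (m i)\<^sup>2) = 0" by (intro sum.neutral) auto
    then show False using sq by simp
  qed
  have "\<exists>i\<le>n. 0 < m i"
  proof (rule ccontr)
    assume "\<not> (\<exists>i\<le>n. 0 < m i)"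
    then have "\<forall>i\<in>{..n}. 0 \<le> - m i" "(\<Sum>i\<le>n. - m i) = 0" using sum by (auto simp: sum_negf not_less)
    then show False using nz sum_nonneg_eq_0_iff[of "{..n}" "\<lambda>i. - m i"] by auto
  qed
  then obtain i where i: "i \<le> n" "0 < m i" by blast
  have "\<exists>i\<le>n. m i < 0"
  proof (rule ccontr)
    assume "\<not> (\<exists>i\<le>n. m i < 0)"
    then show False using nz sum sum_nonneg_eq_0_iff[of "{..n}" "\<lambda>i. m i"] by (auto simp: not_less)
  qed
  then obtain j where j: "j \<le> n" "m j < 0" by blast
  have ij: "i \<noteq> j" using i j by auto
  have "{..n} = insert i (insert j ({..n} - {i, j}))" using i j by auto
  then have "(\<Sum>k\<le>n. (m k)\<^sup>2) = (\<Sum>k\<in>insert i (insert j ({..n} - {i, j})). (m k)\<^sup>2)" by simp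
  also have "\<dots> = (m i)\<^sup>2 + ((m j)\<^sup>2 + (\<Sum>k\<in>{..n} - {i, j}. (m k)\<^sup>2))"
    using ij by simp
  finally have s: "(m i)\<^sup>2 + (m j)\<^sup>2 + (\<Sum>k\<in>{..n} - {i, j}. (m k)\<^sup>2) = 2" using sq by simp
  have ge: "m i \<le> (m i)\<^sup>2" "- m j \<le> (m j)\<^sup>2" "0 \<le> (\<Sum>k\<in>{..n} - {i, j}. (m k)\<^sup>2)"
    using self_le_power[of "m i" 2] self_le_power[of "- m j" 2] i j by (auto intro: sum_nonneg)
  then have "m i = 1" "m j = -1" using i j s by linarith+
  then have "(\<Sum>k\<in>{..n} - {i, j}. (m k)\<^sup>2) = 0" using s by simp
  then have "m k = 0" if "k \<le> n" "k \<noteq> i" "k \<noteq> j" for k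
    using that sum_nonneg_eq_0_iff[of "{..n} - {i, j}" "\<lambda>k. (m k)\<^sup>2"] by auto
  then show thesis using that i j ij \<open>m i = 1\<close> \<open>m j = -1\<close> by blast
qed

text \<open>A number and its square have the same parity. This pushes the second smallest norm of
  the lattice up to at least \<open>sqrt 8\<close>.\<close>

lemma even_sum_squares:
  fixes m :: "nat \<Rightarrow> int"
  assumes "(\<Sum>i\<le>n. m i) = 0"
  shows "even (\<Sum>i\<le>n. (m i)\<^sup>2)"
proof -
  have "(\<Sum>i\<le>n. (m i)\<^sup>2) = (\<Sum>i\<le>n. (m i)\<^sup>2 - m i)" using assms by (simp add: sum_subtractf)
  also have "even \<dots>" by (intro dvd_sum) (simp add: power2_eq_square)
  finally show ?thesis .
qed

text \<open>If \<open>c q\<close> is far below \<open>0\<close>, the coordinate \<open>q\<close> alone suffices; otherwise no \<open>c k\<close> is far below \<open>0\<close>,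
  and the positive coordinates of \<open>m\<close> survive.\<close>

lemma sum_squares_shifted:
  fixes m :: "nat \<Rightarrow> int" and c :: "nat \<Rightarrow> real"
  assumes q: "q \<le> n" "m q < 0" and sum: "(\<Sum>i\<le>n. m i) = 0" and sq: "(\<Sum>i\<le>n. (m i)\<^sup>2) \<noteq> 2"
    and c: "\<And>k. k \<le> n \<Longrightarrow> c q \<le> c k" "(\<Sum>i\<le>n. c i) = 0"
  shows "81/32 \<le> (\<Sum>i\<le>n. (m i + c i)\<^sup>2)"
proof -
  have part: "(\<Sum>i\<in>S. (m i + c i)\<^sup>2) \<le> (\<Sum>i\<le>n. (m i + c i)\<^sup>2)" if "S \<subseteq> {..n}" for S
    using that by (intro sum_mono2) auto
  have "(\<Sum>i\<le>n. c q) \<le> (\<Sum>i\<le>n. c i)" by (intro sum_mono) (use c in auto)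
  then have cq: "c q \<le> 0" using c(2) by (simp add: mult_le_0_iff)
  define x where "x = - c q"
  have x: "0 \<le> x" unfolding x_def using cq by simp
  have sq_q: "(1 + x)\<^sup>2 \<le> (m q + c q)\<^sup>2"
  proof -
    have "(1 + x)\<^sup>2 \<le> (- (m q + c q))\<^sup>2" using q x by (intro power_mono) (auto simp: x_def)
    then show ?thesis by (simp only: power2_minus)
  qed
  have drop: "real_of_int (m k) - x \<le> m k + c k" if "k \<le> n" for k using c that unfolding x_def by simp
  show ?thesis
  proof (cases "3/5 \<le> x")
    \<comment> \<open>The threshold 3/5 is just large enough: \<open>(8/5)\<^sup>2 = 64/25\<close>
      exceeds 81/32.\<close>
    case True
    then have "(8/5)\<^sup>2 \<le> (1 + x)\<^sup>2" by (intro power_mono) auto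
    moreover have "(8/5 :: real)\<^sup>2 = 64/25" by (simp add: power2_eq_square)
    ultimately show ?thesis using part[of "{q}"] sq_q q by simp
  next
    case False
    have "\<exists>i\<le>n. 0 < m i"
    proof (rule ccontr)
      assume "\<not> (\<exists>i\<le>n. 0 < m i)"
      then have "\<forall>i\<in>{..n}. 0 \<le> - m i" "(\<Sum>i\<le>n. - m i) = 0" using sum by (auto simp: sum_negf not_less)
      then show False using q sum_nonneg_eq_0_iff[of "{..n}" "\<lambda>i. - m i"] by auto
    qed
    then obtain i where i: "i \<le> n" "0 < m i" by blast
    then have qi: "q \<noteq> i" using q by auto
    consider (big) k where "k \<le> n" "2 \<le> m k" | (two) j where "j \<le> n" "j \<noteq> i" "0 < m j"
      | (one) "m i = 1" "\<And>j. j \<le> n \<Longrightarrow> j \<noteq> i \<Longrightarrow> m j \<le> 0" using i by force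
    then show ?thesis
    proof cases
      case big
      then have "q \<noteq> k" using q by auto
      have "2 - x \<le> m k + c k" using drop[of k] big by linarith
      then have "(2 - x)\<^sup>2 \<le> (m k + c k)\<^sup>2" using False by (intro power_mono) auto
      moreover have "(m q + c q)\<^sup>2 + (m k + c k)\<^sup>2 \<le> (\<Sum>i\<le>n. (m i + c i)\<^sup>2)"
        using part[of "{q, k}"] \<open>q \<noteq> k\<close> q big by simp
      moreover have "(1 + x)\<^sup>2 + (2 - x)\<^sup>2 = 9/2 + 2 * (x - 1/2)\<^sup>2"
        by (simp add: power2_eq_square algebra_simps)
      ultimately show ?thesis using sq_q zero_le_power2[of "x - 1/2"] by linarith
    next
      case two
      then have ne: "q \<noteq> i" "q \<noteq> j" "i \<noteq> j" using q i by auto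
      have "1 - x \<le> m i + c i" "1 - x \<le> m j + c j" using drop[of i] drop[of j] two i by linarith+
      then have "(1 - x)\<^sup>2 \<le> (m i + c i)\<^sup>2" "(1 - x)\<^sup>2 \<le> (m j + c j)\<^sup>2"
        using False by (auto intro!: power_mono)
      moreover have "(m q + c q)\<^sup>2 + ((m i + c i)\<^sup>2 + (m j + c j)\<^sup>2) \<le> (\<Sum>i\<le>n. (m i + c i)\<^sup>2)"
        using part[of "{q, i, j}"] ne q i two by simp
      moreover have "(1 + x)\<^sup>2 + 2 * (1 - x)\<^sup>2 = 8/3 + 3 * (x - 1/3)\<^sup>2"
        by (simp add: power2_eq_square algebra_simps)
      ultimately show ?thesis using sq_q zero_le_power2[of "x - 1/3"] by linarith
    next
      \<comment> \<open>With a single positive entry, equal to 1, the only negative entry is -1 at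
        \<open>q\<close>; then \<open>m\<close> is a root, which \<open>sq\<close> excludes.\<close>
      case one
      have "{..n} = insert i (insert q ({..n} - {i, q}))" using i q by auto
      then have split: "(\<Sum>k\<le>n. f k) = f i + (f q + (\<Sum>k\<in>{..n} - {i, q}. f k))" for f :: "nat \<Rightarrow> int"
        using qi by (metis (no_types, lifting) Diff_iff finite_Diff finite_atMost finite_insert
            insertCI insertE sum.insert)
      have "\<forall>k\<in>{..n} - {i, q}. 0 \<le> - m k" using one by auto
      moreover have "(\<Sum>k\<in>{..n} - {i, q}. - m k) \<le> 0"
        using split[of m] sum one(1) q by (simp add: sum_negf)
      ultimately have "(\<Sum>k\<in>{..n} - {i, q}. - m k) = 0"
        by (meson order_antisym sum_nonneg)
      then have "\<forall>k\<in>{..n} - {i, q}. - m k = 0"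
        using \<open>\<forall>k\<in>{..n} - {i, q}. 0 \<le> - m k\<close>
        by (subst (asm) sum_nonneg_eq_0_iff) auto
      then have z: "(\<Sum>k\<in>{..n} - {i, q}. m k) = 0" "(\<Sum>k\<in>{..n} - {i, q}. (m k)\<^sup>2) = 0"
        by (auto intro!: sum.neutral)
      then have "m q = - 1" using split[of m] sum one(1) by simp
      then have "(\<Sum>k\<le>n. (m k)\<^sup>2) = 2" using split[of "\<lambda>k. (m k)\<^sup>2"] z one(1) by simp
      then show ?thesis using sq by blast
    qed
  qed
qed

section \<open>The lattice of a regular simplex\<close>

text \<open>The \<open>w i\<close> are the vertices of a regular simplex of edge length 2 centred at
  the origin. The identity \<open>parseval\<close> says that they form a tight frame; in particular
  they span the space.\<close>

locale simplex_lattice =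
  fixes n :: nat and w :: "nat \<Rightarrow> 'a::euclidean_space"
  assumes n_ge_2: "2 \<le> n"
    and inner_w: "\<And>i j. i \<le> n \<Longrightarrow> j \<le> n \<Longrightarrow> w i \<bullet> w j = (if i = j then 2 else 0) - 2 / (real n + 1)"
    and parseval: "\<And>y. (\<Sum>i\<le>n. (y \<bullet> w i)\<^sup>2) = 2 * (norm y)\<^sup>2"
begin

text \<open>This is the root lattice A_n scaled to minimal norm 2, described by integrality so that
  \<open>coord\<close> yields integer coordinates of sum zero.\<close>

definition L :: "'a set" where "L = {x. \<forall>i\<le>n. x \<bullet> w i / 2 \<in> \<int>}"

definition coord :: "'a \<Rightarrow> nat \<Rightarrow> int" where "coord x i = \<lfloor>x \<bullet> w i / 2\<rfloor>"

text \<open>A root raises coordinate \<open>i\<close> and lowers coordinate \<open>j\<close> by 1,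
  so it changes the weighted sum by \<open>i - j\<close>, which is nonzero modulo
  \<open>n + 1\<close>.\<close>

definition col :: "'a \<Rightarrow> real" where
  "col x = of_int ((\<Sum>i\<le>n. int i * coord x i) mod (int n + 1))"

text \<open>The rows of the Gram matrix sum to 0, so the sum is orthogonal to every
  \<open>w j\<close>, and \<open>parseval\<close> makes it vanish.\<close>

lemma sum_w: "(\<Sum>i\<le>n. w i) = 0"
proof -
  have "w j \<bullet> (\<Sum>i\<le>n. w i) = 0" if "j \<le> n" for j
  proof -
    have "w j \<bullet> (\<Sum>i\<le>n. w i) = (\<Sum>i\<le>n. (if j = i then 2 else 0) - 2 / (real n + 1))"
      unfolding inner_sum_right using inner_w that by (intro sum.cong) auto
    also have "\<dots> = 2 - (real n + 1) * (2 / (real n + 1))" using that by (simp add: sum_subtractf)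
    also have "\<dots> = 0"
    proof -
      have "real n + 1 \<noteq> 0" by linarith
      then show ?thesis by (metis diff_self nonzero_eq_divide_eq mult.commute)
    qed
    finally show ?thesis .
  qed
  then have "2 * (norm (\<Sum>i\<le>n. w i))\<^sup>2 = 0"
    by (subst parseval[symmetric]) (simp add: inner_commute)
  then show ?thesis by simp
qed

lemma sum_inner_w: "(\<Sum>i\<le>n. y \<bullet> w i) = 0"
  using sum_w by (simp add: inner_sum_right[symmetric])

lemma eq_if_inner_eq:
  assumes "\<And>i. i \<le> n \<Longrightarrow> x \<bullet> w i = y \<bullet> w i"
  shows "x = y"
proof -
  have "2 * (norm (x - y))\<^sup>2 = 0"
    by (subst parseval[symmetric]) (simp add: inner_diff_left assms)
  then show ?thesis by simp
qed

lemma inner_w_coord: "x \<in> L \<Longrightarrow> i \<le> n \<Longrightarrow> x \<bullet> w i = 2 * of_int (coord x i)"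
  unfolding L_def coord_def by (auto simp: Ints_def)

lemma sum_coord: "x \<in> L \<Longrightarrow> (\<Sum>i\<le>n. coord x i) = 0"
proof -
  assume "x \<in> L"
  then have "(\<Sum>i\<le>n. 2 * real_of_int (coord x i)) = 0"
    using sum_inner_w[of x] inner_w_coord by simp
  then have "real_of_int (\<Sum>i\<le>n. coord x i) = 0" by (simp flip: sum_distrib_left)
  then show ?thesis by (simp only: of_int_eq_0_iff)
qed

lemma norm_coord: "x \<in> L \<Longrightarrow> (norm x)\<^sup>2 = 2 * of_int (\<Sum>i\<le>n. (coord x i)\<^sup>2)"
proof -
  assume "x \<in> L"
  then have "2 * (norm x)\<^sup>2 = (\<Sum>i\<le>n. (2 * real_of_int (coord x i))\<^sup>2)"
    using parseval[of x] inner_w_coord by simp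
  also have "\<dots> = 4 * of_int (\<Sum>i\<le>n. (coord x i)\<^sup>2)"
    by (simp add: power_mult_distrib sum_distrib_left)
  finally show ?thesis by simp
qed

lemma norm_2_iff: "x \<in> L \<Longrightarrow> norm x = 2 \<longleftrightarrow> (\<Sum>i\<le>n. (coord x i)\<^sup>2) = 2"
proof -
  assume x: "x \<in> L"
  have "norm x = 2 \<longleftrightarrow> (norm x)\<^sup>2 = 2\<^sup>2" 
    using power2_eq_iff_nonneg[of "norm x" 2] by simp
  also have "\<dots> \<longleftrightarrow> (\<Sum>i\<le>n. (coord x i)\<^sup>2) = 2"
    unfolding norm_coord[OF x] by (simp flip: of_int_sum)
  finally show ?thesis .
qed

lemma root_form:
  assumes "e \<in> L" "norm e = 2"
  obtains i j where "i \<le> n" "j \<le> n" "i \<noteq> j" "e = w i - w j"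
proof -
  obtain i j where ij: "i \<le> n" "j \<le> n" "i \<noteq> j" "coord e i = 1" "coord e j = -1"
    "\<And>k. k \<le> n \<Longrightarrow> k \<noteq> i \<Longrightarrow> k \<noteq> j \<Longrightarrow> coord e k = 0"
    using int_root_form[OF sum_coord[OF assms(1)] iffD1[OF norm_2_iff[OF assms(1)] assms(2)]] by blast
  have "e = w i - w j"
  proof (rule eq_if_inner_eq)
    fix k assume k: "k \<le> n"
    then show "e \<bullet> w k = (w i - w j) \<bullet> w k"
      using ij inner_w_coord[OF assms(1) k] inner_w[of i k] inner_w[of j k]
      by (cases "k = i"; cases "k = j") (auto simp: inner_diff_left)
  qed
  then show thesis using that ij by blast
qed

lemma L_diff: "x \<in> L \<Longrightarrow> y \<in> L \<Longrightarrow> x - y \<in> L"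
  unfolding L_def by (auto simp: inner_diff_left diff_divide_distrib)

lemma root_mem: "i \<le> n \<Longrightarrow> j \<le> n \<Longrightarrow> w i - w j \<in> L"
  unfolding L_def using inner_w by (auto simp: inner_diff_left)

sublocale colored_lattice L col "real n"
proof
  show "0 \<in> L" unfolding L_def by simp
  show "x - y \<in> L" if "x \<in> L" "y \<in> L" for x y using that by (rule L_diff)
  show "norm x = 2 \<or> 14/5 \<le> norm x" if x: "x \<in> L" "x \<noteq> 0" for x
  proof -
    define s where "s = (\<Sum>i\<le>n. (coord x i)\<^sup>2)"
    have s: "(norm x)\<^sup>2 = 2 * real_of_int s" unfolding s_def using norm_coord x by blast
    moreover have "0 < (norm x)\<^sup>2" using x by simp
    ultimately have "0 < s" by simp
    moreover have "even s" unfolding s_def using even_sum_squares sum_coord x by blast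
    ultimately consider "s = 2" | "4 \<le> s" by fastforce
    then show ?thesis
    proof cases
      case 1
      then show ?thesis using norm_2_iff x unfolding s_def by blast
    next
      case 2
      then have "(14/5)\<^sup>2 \<le> (norm x)\<^sup>2" using s by (simp add: power2_eq_square)
      then show ?thesis using power2_le_imp_le norm_ge_zero by blast
    qed
  qed
  show "0 \<le> col x" "col x \<le> real n" for x
  proof -
    have "(\<Sum>i\<le>n. int i * coord x i) mod (int n + 1) < int n + 1" by (intro pos_mod_bound) simp
    then show "col x \<le> real n" unfolding col_def by linarith
  qed (simp add: col_def)
  show "1 \<le> \<bar>col x - col y\<bar>" if xy: "x \<in> L" "y \<in> L" "norm (x - y) = 2" for x y
  proof -
    obtain i j where ij: "i \<le> n" "j \<le> n" "i \<noteq> j" "x - y = w i - w j"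
      using root_form[OF L_diff] xy by metis
    have co: "coord x k - coord y k = (if k = i then 1 else 0) - (if k = j then 1 else 0)" if "k \<le> n" for k
    proof -
      have "2 * real_of_int (coord x k) - 2 * of_int (coord y k) = (w i - w j) \<bullet> w k"
        unfolding ij(4)[symmetric] using inner_w_coord that xy by (simp add: inner_diff_left)
      also have "\<dots> = 2 * of_int ((if k = i then 1 else 0) - (if k = j then 1 else 0))"
        using inner_w ij that by (auto simp: inner_diff_left)
      finally have "real_of_int (coord x k - coord y k)
          = of_int ((if k = i then 1 else 0) - (if k = j then 1 else 0))"
        by (simp split: if_splits)
      then show ?thesis by (simp only: of_int_eq_iff)
    qed
    have "(\<Sum>k\<le>n. int k * coord x k) - (\<Sum>k\<le>n. int k * coord y k)
        = (\<Sum>k\<le>n. int k * ((if k = i then 1 else 0) - (if k = j then 1 else 0)))"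
      unfolding sum_subtractf[symmetric] right_diff_distrib[symmetric]
      using co by (intro sum.cong) auto
    also have "\<dots> = (\<Sum>k\<le>n. (if k = i then int i else 0) - (if k = j then int j else 0))"
      by (intro sum.cong) auto
    also have "\<dots> = int i - int j" using ij by (simp add: sum_subtractf)
    finally have d: "(\<Sum>k\<le>n. int k * coord x k) - (\<Sum>k\<le>n. int k * coord y k) = int i - int j" .
    have "(\<Sum>k\<le>n. int k * coord x k) mod (int n + 1) \<noteq> (\<Sum>k\<le>n. int k * coord y k) mod (int n + 1)"
    proof
      assume "(\<Sum>k\<le>n. int k * coord x k) mod (int n + 1) = (\<Sum>k\<le>n. int k * coord y k) mod (int n + 1)"
      then have "int n + 1 dvd int i - int j" unfolding mod_eq_dvd_iff d .
      then have "\<bar>int n + 1\<bar> \<le> \<bar>int i - int j\<bar>" using ij(3) by (intro dvd_imp_le_int) auto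
      then show False using ij by auto
    qed
    then show ?thesis unfolding col_def by linarith
  qed
qed

text \<open>The hypothesis on \<open>D\<close> makes \<open>D \<bullet> w q / 2\<close> the smallest
  coordinate of the displacement, as \<open>sum_squares_shifted\<close> requires. By
  \<open>parseval\<close> its bound 81/32 is half the square of 9/4.\<close>

lemma vertex_far:
  assumes e: "e \<in> L" "norm e \<noteq> 2" and q: "q \<le> n" "0 < (- w q) \<bullet> e"
    and D: "\<And>k. k \<le> n \<Longrightarrow> D \<bullet> w q \<le> D \<bullet> w k"
  shows "9/4 \<le> norm (e + D)"
proof -
  have "coord e q < 0" using q inner_w_coord[OF e(1) q(1)] by (simp add: inner_commute)
  then have "81/32 \<le> (\<Sum>i\<le>n. (coord e i + D \<bullet> w i / 2)\<^sup>2)"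
    using q e D norm_2_iff sum_coord sum_inner_w[of D]
    by (intro sum_squares_shifted[of q]) (auto simp: sum_divide_distrib[symmetric])
  also have "\<dots> = (\<Sum>i\<le>n. ((e + D) \<bullet> w i)\<^sup>2 / 4)"
    using inner_w_coord[OF e(1)] by (intro sum.cong) (auto simp: inner_add_left power_divide field_simps power2_eq_square)
  also have "\<dots> = (norm (e + D))\<^sup>2 / 2" using parseval[of "e + D"] by (simp add: sum_divide_distrib[symmetric])
  finally have "(9/4)\<^sup>2 \<le> (norm (e + D))\<^sup>2" by (simp add: power2_eq_square)
  then show ?thesis using power2_le_imp_le norm_ge_zero by blast
qed

text \<open>The inner product of \<open>w q\<close> with a root \<open>w i - w j\<close> is negative
  only for \<open>j = q\<close>. Hence the shortest bonds crossing a vertex cut are controlled by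
  the slacks.\<close>

lemma vertex_root:
  assumes e: "e \<in> L" "norm e = 2" and q: "q \<le> n" "0 < (- w q) \<bullet> e"
  obtains k where "k \<le> n" "k \<noteq> q" "e = w k - w q"
proof -
  obtain i j where ij: "i \<le> n" "j \<le> n" "i \<noteq> j" "e = w i - w j" using root_form e by blast
  have "j = q"
    using q ij inner_w[of q i] inner_w[of q j] by (auto simp: inner_diff_right split: if_splits)
  then show thesis using that ij by blast
qed

text \<open>For shortest vectors the condition on \<open>D\<close> is the first order criterion; the
  others are covered by \<open>vertex_far\<close>.\<close>

lemma vertex_admissible:
  assumes "e \<in> L" "q \<le> n" "0 < (- w q) \<bullet> e" "\<And>k. k \<le> n \<Longrightarrow> D \<bullet> w q \<le> D \<bullet> w k"
  shows "2 \<le> norm (e + D)"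
proof (cases "norm e = 2")
  case True
  then obtain k where "k \<le> n" "e = w k - w q" using vertex_root assms by metis
  then show ?thesis using True assms(4)[of k]
    by (intro two_le_norm_add_inner) (auto simp: inner_diff_right inner_commute)
next
  case False
  then show ?thesis using vertex_far[OF assms(1) False assms(2-4)] by simp
qed

end

section \<open>The chain of vertex gaps\<close>

context simplex_lattice
begin

lemma inner_root:
  assumes "i \<le> n" "j \<le> n" "k \<le> n"
  shows "w i \<bullet> (w j - w k) = (if i = j then 2 else 0) - (if i = k then 2 else 0)"
  using assms inner_w by (simp add: inner_diff_right)

lemma norm_w: "i \<le> n \<Longrightarrow> norm (w i) \<le> 2"
proof -
  assume i: "i \<le> n"
  have "(norm (w i))\<^sup>2 = 2 - 2 / (real n + 1)"
    using inner_w[OF i i] by (simp add: power2_norm_eq_inner)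
  also have "\<dots> \<le> 2 - 0" by (intro diff_left_mono) simp
  also have "\<dots> \<le> 2\<^sup>2" by simp
  finally show ?thesis by (rule power2_le_imp_le) simp
qed

text \<open>At full cutoff and height the halves move by half of \<open>t - \<tau>\<close> and half
  of \<open>t + \<tau>\<close>. The slacks of both lie strictly between 0 and those of
  \<open>t\<close> exactly if \<open>\<tau>\<close> is smaller than \<open>t\<close> in the sense of
  \<open>slack\<close>.\<close>

lemma vertex_step:
  assumes pq: "p \<le> n" "q \<le> n" "p \<noteq> q"
    and slack: "\<And>k. k \<le> n \<Longrightarrow> k \<noteq> p \<Longrightarrow> \<bar>\<tau> \<bullet> (w k - w p)\<bar> < t \<bullet> (w k - w p)"
    and tau: "\<And>k. k \<le> n \<Longrightarrow> k \<noteq> q \<Longrightarrow> 0 < \<tau> \<bullet> (w k - w q)"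
    and imp: "improvable (gap (- w q) b' \<tau>)"
  shows "improvable (gap (- w p) b t)"
proof -
  have "finite ((\<lambda>k. t \<bullet> (w k - w p) - \<bar>\<tau> \<bullet> (w k - w p)\<bar>) ` ({..n} - {p}))" by simp
  from finite_positive_bound[OF this] obtain m where m: "0 < m"
    "\<And>k. k \<le> n \<Longrightarrow> k \<noteq> p \<Longrightarrow> m \<le> t \<bullet> (w k - w p) - \<bar>\<tau> \<bullet> (w k - w p)\<bar>"
    using slack by (metis (mono_tags, lifting) DiffI atMost_iff diff_gt_0_iff_gt imageI singletonD)
  \<comment> \<open>\<open>m / 4\<close> leaves the slacks a margin for the height; 2/5 yields the
    bound 4/5 because \<open>norm (w p) \<le> 2\<close>.\<close>
  define c where "c = min (m / 4) (2/5)"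
  have c: "0 < c" "4 * c \<le> m" "c \<le> 2/5" unfolding c_def using m by auto
  \<comment> \<open>The term with \<open>w p\<close> cancels the height shift along
    \<open>- w p\<close> in the inner zone.\<close>
  define \<sigma> where "\<sigma> = (1/2) *\<^sub>R (t - \<tau>) + c *\<^sub>R w p"
  have N: "w p \<bullet> (w k - w p) = - 2" if "k \<le> n" "k \<noteq> p" for k
    using inner_root[of p k p] that pq by simp
  have s: "2 * c \<le> (s - c *\<^sub>R w p) \<bullet> (w k - w p)" "(s - c *\<^sub>R w p) \<bullet> (w k - w p) \<le> t \<bullet> (w k - w p)"
    if "s \<in> {\<sigma>, \<sigma> + \<tau>}" "k \<le> n" "k \<noteq> p" for s k
  proof -
    have "s - c *\<^sub>R w p = (1/2) *\<^sub>R (t - \<tau>) \<or> s - c *\<^sub>R w p = (1/2) *\<^sub>R (t + \<tau>)"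
    proof -
      have "(1/2) *\<^sub>R (t - \<tau>) + \<tau> = (1/2) *\<^sub>R (t + \<tau>)"
        by (simp add: algebra_simps) (simp flip: scaleR_add_left)
      moreover have "\<sigma> - c *\<^sub>R w p = (1/2) *\<^sub>R (t - \<tau>)" "\<sigma> + \<tau> - c *\<^sub>R w p = (1/2) *\<^sub>R (t - \<tau>) + \<tau>"
        unfolding \<sigma>_def by simp_all
      moreover have "s = \<sigma> \<or> s = \<sigma> + \<tau>" using that(1) by blast
      ultimately show ?thesis by metis
    qed
    then have "(s - c *\<^sub>R w p) \<bullet> (w k - w p) = (t \<bullet> (w k - w p) - \<tau> \<bullet> (w k - w p)) / 2 \<or>
        (s - c *\<^sub>R w p) \<bullet> (w k - w p) = (t \<bullet> (w k - w p) + \<tau> \<bullet> (w k - w p)) / 2"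
    proof (elim disjE)
      assume a: "s - c *\<^sub>R w p = (1/2) *\<^sub>R (t - \<tau>)"
      show ?thesis unfolding a by (simp add: inner_diff_left[of t])
    next
      assume a: "s - c *\<^sub>R w p = (1/2) *\<^sub>R (t + \<tau>)"
      show ?thesis unfolding a by (simp add: inner_add_left[of t])
    qed
    moreover have "\<bar>\<tau> \<bullet> (w k - w p)\<bar> + 4 * c \<le> t \<bullet> (w k - w p)" using m(2)[OF that(2,3)] c by linarith
    ultimately show "2 * c \<le> (s - c *\<^sub>R w p) \<bullet> (w k - w p)"
      "(s - c *\<^sub>R w p) \<bullet> (w k - w p) \<le> t \<bullet> (w k - w p)"
      using c(1) by argo+
  qed
  have sk: "0 \<le> s \<bullet> (w k - w p)"
      "s \<bullet> (w k - w p) \<le> t \<bullet> (w k - w p) - 2 * c"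
    if "s \<in> {\<sigma>, \<sigma> + \<tau>}" "k \<le> n" "k \<noteq> p" for s k
    using s[OF that] N[OF that(2,3)] by (simp_all add: inner_diff_left[of s])
  have vertexD: "D \<bullet> w p \<le> D \<bullet> w k" if "k \<le> n" "k \<noteq> p \<Longrightarrow> 0 \<le> D \<bullet> (w k - w p)" for D k
    using that by (cases "k = p") (auto simp: inner_diff_right)
  \<comment> \<open>The lemma is used with \<open>\<epsilon> = c\<close>, so the height
    \<open>z\<close> runs from 0 to \<open>c\<close> and adds \<open>2 * z\<close> to the
    slack.\<close>
  have low: "0 \<le> (z *\<^sub>R (- w p) + f *\<^sub>R s) \<bullet> (w k - w p)"
    "0 \<le> (t - (z *\<^sub>R (- w p) + f *\<^sub>R s)) \<bullet> (w k - w p)"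
    if "0 \<le> f" "f \<le> 1" "c - c \<le> z" "z \<le> c" "s \<in> {\<sigma>, \<sigma> + \<tau>}" "k \<le> n" "k \<noteq> p" for z f s k
  proof -
    have e: "(z *\<^sub>R (- w p) + f *\<^sub>R s) \<bullet> (w k - w p) = 2 * z + f * (s \<bullet> (w k - w p))"
      using N[OF that(6,7)] by (simp only: inner_add_left inner_scaleR_left inner_minus_left)
    have "0 \<le> f * (s \<bullet> (w k - w p))" using sk[OF that(5-7)] that by simp
    then show "0 \<le> (z *\<^sub>R (- w p) + f *\<^sub>R s) \<bullet> (w k - w p)" unfolding e using that by simp
    have "f * (s \<bullet> (w k - w p)) \<le> s \<bullet> (w k - w p)"
      using sk[OF that(5-7)] that by (intro mult_left_le_one_le) auto
    then show "0 \<le> (t - (z *\<^sub>R (- w p) + f *\<^sub>R s)) \<bullet> (w k - w p)"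
      unfolding inner_diff_left e using sk(2)[OF that(5-7)] that by linarith
  qed
  show ?thesis
  proof (rule improvable_gap_transfer[OF imp, of "w q - w p" "- w p" t c c \<sigma>])
    show "w q - w p \<in> L" using pq root_mem by blast
    show "- w p \<bullet> (w q - w p) \<noteq> 0" using N[of q] pq by simp
    show "2 \<le> norm (e + t)" if "e \<in> L" "0 < - w p \<bullet> e" for e
    proof (rule vertex_admissible[OF that(1) pq(1) that(2)], rule vertexD)
      show "0 \<le> t \<bullet> (w k - w p)" if "k \<le> n" "k \<noteq> p" for k using slack[OF that] by linarith
    qed
    show "2 \<le> norm (e + (z *\<^sub>R (- w p) + f *\<^sub>R s))"
      if "e \<in> L" "0 < - w p \<bullet> e" "0 \<le> f" "f \<le> 1" "c - c \<le> z" "z \<le> c" "s \<in> {\<sigma>, \<sigma> + \<tau>}" for e z f s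
      using low(1)[OF that(3-7)] that pq by (intro vertex_admissible[of e p] vertexD) blast+
    show "2 \<le> norm (e + (t - (z *\<^sub>R (- w p) + f *\<^sub>R s)))"
      if "e \<in> L" "0 < - w p \<bullet> e" "0 \<le> f" "f \<le> 1" "c - c \<le> z" "z \<le> c" "s \<in> {\<sigma>, \<sigma> + \<tau>}" for e z f s
      using low(2)[OF that(3-7)] that pq by (intro vertex_admissible[of e p] vertexD) blast+
    have "c * norm (- w p) \<le> (2/5) * 2" using c norm_w[OF pq(1)] by (intro mult_mono) auto
    then show "c * norm (- w p) \<le> 4/5" by simp
    show "0 < e \<bullet> \<tau>" if "e \<in> L" "norm e = 2" "0 < - w q \<bullet> e" for e
    proof -
      note root = vertex_root[OF that(1,2) pq(2) that(3)]
      obtain k where "k \<le> n" "k \<noteq> q" "e = w k - w q" by (rule root)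
      then show ?thesis using tau by (simp add: inner_commute)
    qed
    show "9/4 \<le> norm (e + f *\<^sub>R \<tau>)" if "e \<in> L" "norm e \<noteq> 2" "0 < - w q \<bullet> e" "0 \<le> f" "f \<le> 1" for e f
    proof (rule vertex_far[OF that(1,2) pq(2) that(3)])
      fix k assume "k \<le> n"
      then have "\<tau> \<bullet> w q \<le> \<tau> \<bullet> w k" using tau[of k] by (cases "k = q") (auto simp: inner_diff_right)
      then show "f *\<^sub>R \<tau> \<bullet> w q \<le> f *\<^sub>R \<tau> \<bullet> w k" using that by (simp add: mult_left_mono)
    qed
  qed (use c in auto)
qed

lemma L_scale_int: "x \<in> L \<Longrightarrow> of_int m *\<^sub>R x \<in> L"
proof -
  assume "x \<in> L"
  then have "of_int m * (x \<bullet> w i / 2) \<in> \<int>" if "i \<le> n" for i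
    using that unfolding L_def by (intro Ints_mult) auto
  then show ?thesis unfolding L_def by simp
qed

text \<open>A shift by a lattice vector keeps all centers in \<open>L\<close>, and the layer it
  leaves empty contains a lattice point that can be filled without removing anything.\<close>

lemma improvable_vacancies:
  assumes "q \<le> n" "r \<le> n" "q \<noteq> r"
  shows "improvable (gap (- w q) b (w r - w q))"
proof -
  define t where "t = w r - w q"
  \<comment> \<open>Since \<open>t\<close> has inner product 2 with \<open>- w q\<close>, rounding
    \<open>b / 2\<close> up lands in the empty layer.\<close>
  define y where "y = of_int \<lceil>b / 2\<rceil> *\<^sub>R t"
  have t: "t \<in> L" "(- w q) \<bullet> t = 2" unfolding t_def using assms root_mem inner_root[of q r q] by auto
  then have y: "y \<in> L" "b \<le> (- w q) \<bullet> y" "(- w q) \<bullet> y < b + 2"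
    unfolding y_def using L_scale_int by (auto, linarith+)
  have sub: "gap (- w q) b t \<subseteq> L" unfolding gap_def using add_mem t by auto
  moreover have "y \<notin> gap (- w q) b t"
    unfolding gap_def using y t(2) by (auto simp: inner_add_right split: if_splits)
  moreover have "sphere_packing (gap (- w q) b t \<union> {y})"
    using sub y by (intro sphere_packing_subset[OF sphere_packing_L]) auto
  ultimately show ?thesis
    unfolding improvable_def t_def[symmetric] by (intro exI[of _ "{}"] exI[of _ "{y}"]) simp
qed

lemma obtain_other_vertices:
  assumes "p \<le> n"
  obtains q r where "q \<le> n" "r \<le> n" "q \<noteq> p" "r \<noteq> p" "q \<noteq> r"
  by (rule that[of "if p = 0 then 1 else 0" "if p \<le> 1 then 2 else 1"]) (use n_ge_2 in auto)

text \<open>The shift has slack \<open>c\<close> towards every other vertex, whereas the slacks of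
  \<open>w r - w q\<close> at \<open>w p\<close> are at most 2 in absolute value.\<close>

lemma improvable_wide:
  assumes "2 < c" "p \<le> n"
  shows "improvable (gap (- w p) b (- (c / 2) *\<^sub>R w p))"
proof -
  obtain q r where qr: "q \<le> n" "r \<le> n" "q \<noteq> p" "r \<noteq> p" "q \<noteq> r"
    using obtain_other_vertices assms by blast
  show ?thesis
  proof (rule vertex_step[OF _ _ _ _ _ improvable_vacancies[of q r 0]])
    show "\<bar>(w r - w q) \<bullet> (w k - w p)\<bar> < - (c / 2) *\<^sub>R w p \<bullet> (w k - w p)" if "k \<le> n" "k \<noteq> p" for k
      using that assms qr inner_root[of r k p] inner_root[of q k p] inner_root[of p k p]
      by (auto simp: inner_diff_left)
    show "0 < (w r - w q) \<bullet> (w k - w q)" if "k \<le> n" "k \<noteq> q" for k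
      using that assms qr inner_root[of r k q] inner_root[of q k q]
      by (auto simp: inner_diff_left)
  qed (use assms qr in auto)
qed

text \<open>Two steps lead from \<open>p\<close> over \<open>q\<close> to \<open>r\<close>. The
  intermediate \<open>\<tau>\<close> has slacks of absolute value \<open>9/10 * c\<close> at
  \<open>w p\<close>, below \<open>c\<close>; at \<open>w q\<close> its slack is
  \<open>9/10 * c\<close> towards \<open>w p\<close> but \<open>9/5 * c\<close> towards the other
  vertices. The latter leaves room for \<open>3/2 * c\<close> towards \<open>w r\<close>.\<close>

lemma improvable_grow:
  assumes c: "0 < c" and p: "p \<le> n"
    and imp: "\<And>r b. r \<le> n \<Longrightarrow> improvable (gap (- w r) b (- (3/2 * c / 2) *\<^sub>R w r))"
  shows "improvable (gap (- w p) b (- (c / 2) *\<^sub>R w p))"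
proof -
  obtain q r where qr: "q \<le> n" "r \<le> n" "q \<noteq> p" "r \<noteq> p" "q \<noteq> r"
    using obtain_other_vertices p by blast
  define \<tau> where "\<tau> = - ((9/10 * c) *\<^sub>R w q + (9/20 * c) *\<^sub>R w p)"
  have \<tau>: "\<tau> \<bullet> y = - (9/10 * c * (w q \<bullet> y) + 9/20 * c * (w p \<bullet> y))" for y
    unfolding \<tau>_def inner_minus_left inner_add_left inner_scaleR_left ..
  have "improvable (gap (- w q) 0 \<tau>)"
  proof (rule vertex_step[OF _ _ _ _ _ imp[of r 0]])
    show "\<bar>- (3/2 * c / 2) *\<^sub>R w r \<bullet> (w k - w q)\<bar> < \<tau> \<bullet> (w k - w q)" if "k \<le> n" "k \<noteq> q" for k
      using that p c qr inner_root[of r k q] inner_root[of q k q] inner_root[of p k q]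
      unfolding \<tau> by auto
    show "0 < - (3/2 * c / 2) *\<^sub>R w r \<bullet> (w k - w r)" if "k \<le> n" "k \<noteq> r" for k
      using that c qr inner_root[of r k r] by auto
  qed (use p qr in auto)
  then show ?thesis
  proof (rule vertex_step[rotated 5])
    show "\<bar>\<tau> \<bullet> (w k - w p)\<bar> < - (c / 2) *\<^sub>R w p \<bullet> (w k - w p)" if "k \<le> n" "k \<noteq> p" for k
      using that p c qr inner_root[of q k p] inner_root[of p k p]
      unfolding \<tau> by auto
    show "0 < \<tau> \<bullet> (w k - w q)" if "k \<le> n" "k \<noteq> q" for k
      using that p c qr inner_root[of q k q] inner_root[of p k q]
      unfolding \<tau> by auto
  qed (use p qr in auto)
qed

text \<open>Each use of \<open>improvable_grow\<close> multiplies the slack by 3/2, until it exceeds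
  2 and \<open>improvable_wide\<close> applies.\<close>

lemma improvable_vertex_gap:
  assumes "0 < c" "p \<le> n"
  shows "improvable (gap (- w p) b (- (c / 2) *\<^sub>R w p))"
proof -
  obtain k :: nat where "2 / c < (3/2) ^ k" using real_arch_pow[of "3/2"] by auto
  then have "2 < (3/2) ^ k * c" using assms by (simp add: divide_less_eq)
  then show ?thesis using assms
  proof (induction k arbitrary: c p b)
    case 0
    then show ?case using improvable_wide by simp
  next
    case (Suc k)
    have "improvable (gap (- w r) b (- (3/2 * c / 2) *\<^sub>R w r))" if "r \<le> n" for r b
      using Suc.IH[of "3/2 * c" r b] Suc.prems that by (simp add: mult_ac)
    then show ?case using improvable_grow Suc.prems by blast
  qed
qed

section \<open>Gaps with an arbitrary normal\<close>

text \<open>A tiny vertex gap is opened with \<open>\<sigma> = 0\<close>. Moving the slab part of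
  the way along \<open>v\<close> gains at least \<open>c / 2 * \<nu>\<close> to first order on every
  shortest bond that rises along \<open>v\<close>, more than \<open>\<tau>\<close> can cost.\<close>

lemma improvable_gap:
  assumes "v \<noteq> 0"
  shows "improvable (gap v b v)"
proof -
  obtain \<nu> where \<nu>: "\<nu> > 0" "\<And>e. e \<in> L \<Longrightarrow> norm e = 2 \<Longrightarrow> 0 < v \<bullet> e \<Longrightarrow> \<nu> \<le> v \<bullet> e"
    using min_inner by blast
  \<comment> \<open>With \<open>c \<le> 1/2\<close>, both \<open>z\<close> and \<open>1 - z\<close>
    are at least \<open>c / 2\<close>, so one estimate serves below and above the slab.\<close>
  define c where "c = min (1/2) (4 / (5 * norm v))"
  have c: "0 < c" "c \<le> 1/2" "c \<le> 4 / (5 * norm v)" unfolding c_def using assms by auto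
  \<comment> \<open>As \<open>norm \<tau> \<le> 2 * \<theta>\<close>, the first bound serves the
    shortest bonds and the second keeps longer ones above \<open>14/5 - 4/5\<close>.\<close>
  define \<theta> where "\<theta> = min (c * \<nu> / 8) (2/5)"
  have \<theta>: "0 < \<theta>" "\<theta> \<le> c * \<nu> / 8" "\<theta> \<le> 2/5" unfolding \<theta>_def using c \<nu> by auto
  define \<tau> where "\<tau> = - \<theta> *\<^sub>R w 0"
  have "norm \<tau> \<le> \<theta> * 2" unfolding \<tau>_def using \<theta> norm_w[of 0] by simp
  then have \<tau>: "norm \<tau> \<le> 4/5" "4 * norm \<tau> \<le> c * \<nu>" using \<theta> by auto
  have \<tau>i: "0 < \<tau> \<bullet> (w k - w 0)" if "k \<le> n" "k \<noteq> 0" for k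
    unfolding \<tau>_def using inner_root[of 0 k 0] that \<theta> by simp
  have adm: "2 \<le> norm (e + (z *\<^sub>R v + s))"
    if e: "e \<in> L" "0 < v \<bullet> e" and z: "c / 2 \<le> z" and s: "norm s \<le> norm \<tau>" for e z s
  proof -
    have z0: "0 \<le> z" using z c by simp
    have "e \<noteq> 0" using e by auto
    then consider "norm e = 2" | "14/5 \<le> norm e" using norm_cases e by blast
    then show ?thesis
    proof cases
      case 1
      have "c / 2 * \<nu> \<le> z * (v \<bullet> e)" using z z0 \<nu> 1 e by (intro mult_mono) auto
      moreover have "\<bar>e \<bullet> s\<bar> \<le> norm e * norm s" by (rule Cauchy_Schwarz_ineq2)
      ultimately have "0 \<le> z * (v \<bullet> e) + e \<bullet> s" using s \<tau> 1 by simp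
      then show ?thesis using 1
        by (intro two_le_norm_add_inner) (auto simp: inner_add_right inner_commute)
    next
      case 2
      have "(norm e)\<^sup>2 \<le> (norm (e + z *\<^sub>R v))\<^sup>2"
      proof -
        have "(norm (e + z *\<^sub>R v))\<^sup>2 = (norm e)\<^sup>2 + 2 * (z * (v \<bullet> e)) + (norm (z *\<^sub>R v))\<^sup>2"
          unfolding power2_norm_eq_inner by (simp add: inner_add_left inner_add_right inner_commute)
        moreover have "0 \<le> z * (v \<bullet> e)" using z0 e by simp
        ultimately show ?thesis by simp
      qed
      then have "norm e \<le> norm (e + z *\<^sub>R v)" by (rule power2_le_imp_le) simp
      then show ?thesis
        using norm_diff_ineq[of "e + z *\<^sub>R v" s] 2 s \<tau> by (simp add: add.assoc)
    qed
  qed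
  have small: "norm (f *\<^sub>R s) \<le> norm \<tau>" if "0 \<le> f" "f \<le> 1" "s \<in> {0, 0 + \<tau>}" for f s
    using that by (auto simp: mult_left_le_one_le)
  \<comment> \<open>If \<open>v\<close> were orthogonal to all roots, its products with the
    \<open>w i\<close> would be equal, and zero since they sum to zero.\<close>
  have "\<exists>x0\<in>L. v \<bullet> x0 \<noteq> 0"
  proof (rule ccontr)
    assume "\<not> (\<exists>x0\<in>L. v \<bullet> x0 \<noteq> 0)"
    then have eq: "v \<bullet> w i = v \<bullet> w 0" if "i \<le> n" for i
      using root_mem[of i 0] that by (auto simp: inner_diff_right)
    have "(\<Sum>i\<le>n. v \<bullet> w i) = (\<Sum>i\<le>n. v \<bullet> w 0)" by (intro sum.cong refl eq) simp
    then have "(real n + 1) * (v \<bullet> w 0) = 0" using sum_inner_w[of v] by (simp add: add.commute)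
    moreover have "real n + 1 \<noteq> 0" by linarith
    ultimately have "v \<bullet> w 0 = 0" by (simp only: mult_eq_0_iff) simp
    have "v = 0"
    proof (rule eq_if_inner_eq)
      show "v \<bullet> w i = 0 \<bullet> w i" if "i \<le> n" for i
        using eq[OF that] \<open>v \<bullet> w 0 = 0\<close> by simp
    qed
    then show False using assms by blast
  qed
  then obtain x0 where x0: "x0 \<in> L" "v \<bullet> x0 \<noteq> 0" by blast
  have "improvable (gap (- w 0) 0 \<tau>)"
    using improvable_vertex_gap[of "2 * \<theta>" 0 0] \<theta> unfolding \<tau>_def by simp
  then show ?thesis
  proof (rule improvable_gap_transfer[OF _ x0, of _ _ _ _ c "c / 2" 0])
    show "2 \<le> norm (e + v)" if "e \<in> L" "0 < v \<bullet> e" for e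
      using adm[OF that, of 1 0] c by simp
    show "2 \<le> norm (e + (z *\<^sub>R v + f *\<^sub>R s))"
      if "e \<in> L" "0 < v \<bullet> e" "0 \<le> f" "f \<le> 1" "c - c / 2 \<le> z" "z \<le> c" "s \<in> {0, 0 + \<tau>}" for e z f s
      using that(5) by (intro adm[OF that(1,2) _ small[OF that(3,4,7)]]) simp
    show "2 \<le> norm (e + (v - (z *\<^sub>R v + f *\<^sub>R s)))"
      if "e \<in> L" "0 < v \<bullet> e" "0 \<le> f" "f \<le> 1" "c - c / 2 \<le> z" "z \<le> c" "s \<in> {0, 0 + \<tau>}" for e z f s
    proof -
      have "2 \<le> norm (e + ((1 - z) *\<^sub>R v + - (f *\<^sub>R s)))"
        using small[OF that(3,4,7)] that(6) c by (intro adm[OF that(1,2)]) auto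
      then show ?thesis by (simp add: algebra_simps)
    qed
    show "c * norm v \<le> 4/5" using c(3) assms by (simp add: field_simps)
    show "0 < e \<bullet> \<tau>" if "e \<in> L" "norm e = 2" "0 < - w 0 \<bullet> e" for e
    proof -
      note root = vertex_root[OF that(1,2) le0 that(3)]
      obtain k where "k \<le> n" "k \<noteq> 0" "e = w k - w 0" by (rule root)
      then show ?thesis using \<tau>i by (simp add: inner_commute)
    qed
    show "9/4 \<le> norm (e + f *\<^sub>R \<tau>)" if "e \<in> L" "norm e \<noteq> 2" "0 < - w 0 \<bullet> e" "0 \<le> f" "f \<le> 1" for e f
    proof (rule vertex_far[OF that(1,2) _ that(3)])
      fix k assume "k \<le> n"
      then have "\<tau> \<bullet> w 0 \<le> \<tau> \<bullet> w k" using \<tau>i[of k] by (cases "k = 0") (auto simp: inner_diff_right)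
      then show "f *\<^sub>R \<tau> \<bullet> w 0 \<le> f *\<^sub>R \<tau> \<bullet> w k" using that by (simp add: mult_left_mono)
    qed simp
  qed (use c in auto)
qed

end

section \<open>Congruent copies of simplex lattices\<close>

lemma simplex_lattice_orthogonal:
  fixes g :: "'a::euclidean_space \<Rightarrow> 'a"
  assumes "simplex_lattice n w" "orthogonal_transformation g"
  shows "simplex_lattice n (\<lambda>i. g (w i))"
    and "simplex_lattice.L n (\<lambda>i. g (w i)) = g ` simplex_lattice.L n w"
proof -
  interpret simplex_lattice n w by fact
  have inner: "g x \<bullet> g y = x \<bullet> y" for x y using assms(2) unfolding orthogonal_transformation_def by blast
  have surj: "surj g" using assms(2) by (rule orthogonal_transformation_surj)
  show *: "simplex_lattice n (\<lambda>i. g (w i))"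
  proof
    fix y
    obtain x where "y = g x" using surj by blast
    then show "(\<Sum>i\<le>n. (y \<bullet> g (w i))\<^sup>2) = 2 * (norm y)\<^sup>2"
      using parseval[of x] inner by (simp add: power2_norm_eq_inner)
  qed (use n_ge_2 inner_w inner in auto)
  show "simplex_lattice.L n (\<lambda>i. g (w i)) = g ` simplex_lattice.L n w"
  proof (intro set_eqI)
    fix y
    obtain x where y: "y = g x" using surj by blast
    have "g x \<in> g ` simplex_lattice.L n w \<longleftrightarrow> x \<in> simplex_lattice.L n w"
      using orthogonal_transformation_inj[OF assms(2)] by (auto simp: inj_image_mem_iff)
    then show "y \<in> simplex_lattice.L n (\<lambda>i. g (w i)) \<longleftrightarrow> y \<in> g ` simplex_lattice.L n w"
      unfolding y simplex_lattice.L_def[OF *] L_def using inner by simp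
  qed
qed

text \<open>An isometry is orthogonal up to a translation, so the packing is a translate of the
  lattice of the rotated simplex, and only the offset of the cut changes.\<close>

lemma gap_defect_not_completely_saturated:
  assumes "simplex_lattice n w" "congruent_sets (simplex_lattice.L n w) X" "sphere_packing X"
    and "gap_data H P v"
  shows "\<not> completely_saturated (gap_defect X P v)"
proof -
  obtain f where f: "\<forall>x y. dist (f x) (f y) = dist x y" "X = f ` simplex_lattice.L n w"
    using assms(2) unfolding congruent_sets_def by blast
  define a where "a = f 0"
  define g where "g x = f x - a" for x
  have g: "orthogonal_transformation g"
    unfolding orthogonal_transformation_isometry using f(1) by (simp add: g_def a_def dist_norm)
  interpret simplex_lattice n "\<lambda>i. g (w i)" by (rule simplex_lattice_orthogonal(1)[OF assms(1) g])
  have X: "X = (\<lambda>x. a + x) ` L"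
    unfolding simplex_lattice_orthogonal(2)[OF assms(1) g] f(2) image_image
    by (simp add: g_def)
  obtain b where P: "P = {x. v \<bullet> x \<ge> b}" using gap_data_normal[OF assms(4)] by metis
  have eq: "gap_defect X P v = (\<lambda>x. a + x) ` gap v (b - v \<bullet> a) v"
    unfolding gap_defect_def gap_def X P
    by (auto simp: image_iff inner_add_right algebra_simps split: if_splits)
  have "v \<noteq> 0" using assms(4) unfolding gap_data_def by blast
  then have "improvable (gap v (b - v \<bullet> a) v)" by (rule improvable_gap)
  \<comment> \<open>Locality, centred at \<open>a\<close>, doubles as invariance under
    translation.\<close>
  then obtain \<rho> where \<rho>: "\<And>X \<zeta>. sphere_packing X \<Longrightarrow>
      (\<And>p. norm (p - \<zeta>) < \<rho> \<Longrightarrow> p \<in> X \<longleftrightarrow> p - \<zeta> \<in> gap v (b - v \<bullet> a) v) \<Longrightarrow> improvable X"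
    using improvable_local by blast
  have "p \<in> gap_defect X P v \<longleftrightarrow> p - a \<in> gap v (b - v \<bullet> a) v" for p
    unfolding eq by (auto intro: image_eqI[of _ _ "p - a"])
  then have "improvable (gap_defect X P v)"
    using \<rho>[of _ a] sphere_packing_gap_defect[OF assms(3,4)] by blast
  then show ?thesis by (rule improvable_imp_not_completely_saturated)
qed

section \<open>The honeycomb and the fcc lattice\<close>

definition triangle :: "nat \<Rightarrow> real^2" where
  "triangle i = [vector [-1, - sqrt 3 / 3], vector [1, - sqrt 3 / 3], vector [0, 2 * sqrt 3 / 3]] ! i"

text \<open>Two opposite edges of length 2, parallel to the first and the second axis, at heights
  \<open>- sqrt 2 / 2\<close> and \<open>sqrt 2 / 2\<close>.\<close>

definition tetrahedron :: "nat \<Rightarrow> real^3" where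
  "tetrahedron i = [vector [-1, 0, - sqrt 2 / 2], vector [1, 0, - sqrt 2 / 2],
     vector [0, 1, sqrt 2 / 2], vector [0, -1, sqrt 2 / 2]] ! i"

lemma inner_triangle:
  "y \<bullet> triangle 0 = - y $ 1 - sqrt 3 / 3 * y $ 2"
  "y \<bullet> triangle (Suc 0) = y $ 1 - sqrt 3 / 3 * y $ 2"
  "y \<bullet> triangle 2 = 2 * sqrt 3 / 3 * y $ 2"
  unfolding triangle_def by (simp_all add: inner_vec_def sum_2 numeral_2_eq_2)

lemma inner_tetrahedron:
  "y \<bullet> tetrahedron 0 = - y $ 1 - sqrt 2 / 2 * y $ 3"
  "y \<bullet> tetrahedron (Suc 0) = y $ 1 - sqrt 2 / 2 * y $ 3"
  "y \<bullet> tetrahedron 2 = y $ 2 + sqrt 2 / 2 * y $ 3"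
  "y \<bullet> tetrahedron 3 = - y $ 2 + sqrt 2 / 2 * y $ 3"
  unfolding tetrahedron_def by (simp_all add: inner_vec_def sum_3 numeral_2_eq_2 numeral_3_eq_3)

lemma triangle_component:
  "triangle 0 $ 1 = -1" "triangle 0 $ 2 = - sqrt 3 / 3"
  "triangle (Suc 0) $ 1 = 1" "triangle (Suc 0) $ 2 = - sqrt 3 / 3"
  "triangle 2 $ 1 = 0" "triangle 2 $ 2 = 2 * sqrt 3 / 3"
  unfolding triangle_def by (simp_all add: numeral_2_eq_2)

lemma tetrahedron_component:
  "tetrahedron 0 $ 1 = -1" "tetrahedron 0 $ 2 = 0" "tetrahedron 0 $ 3 = - sqrt 2 / 2"
  "tetrahedron (Suc 0) $ 1 = 1" "tetrahedron (Suc 0) $ 2 = 0" "tetrahedron (Suc 0) $ 3 = - sqrt 2 / 2"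
  "tetrahedron 2 $ 1 = 0" "tetrahedron 2 $ 2 = 1" "tetrahedron 2 $ 3 = sqrt 2 / 2"
  "tetrahedron 3 $ 1 = 0" "tetrahedron 3 $ 2 = -1" "tetrahedron 3 $ 3 = sqrt 2 / 2"
  unfolding tetrahedron_def by (simp_all add: numeral_2_eq_2 numeral_3_eq_3)

lemma le_2_cases: "i \<le> (2::nat) \<longleftrightarrow> i = 0 \<or> i = Suc 0 \<or> i = 2"
  by auto

lemma le_3_cases: "i \<le> (3::nat) \<longleftrightarrow> i = 0 \<or> i = Suc 0 \<or> i = 2 \<or> i = 3"
  by auto

lemma atMost_2: "{..2::nat} = {0, Suc 0, 2}"
  using le_2_cases by auto

lemma atMost_3: "{..3::nat} = {0, Suc 0, 2, 3}"
  using le_3_cases by auto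

lemma simplex_lattice_triangle: "simplex_lattice 2 triangle"
proof
  show "triangle i \<bullet> triangle j = (if i = j then 2 else 0) - 2 / (real 2 + 1)"
    if "i \<le> 2" "j \<le> 2" for i j
    using that unfolding le_2_cases
    by (elim disjE) (simp_all add: inner_triangle triangle_component)
  show "(\<Sum>i\<le>2. (y \<bullet> triangle i)\<^sup>2) = 2 * (norm y)\<^sup>2" for y
  proof -
    have "(norm y)\<^sup>2 = y $ 1 * y $ 1 + y $ 2 * y $ 2"
      unfolding power2_norm_eq_inner by (simp add: inner_vec_def sum_2)
    then show ?thesis
      unfolding atMost_2 by (simp add: inner_triangle power2_eq_square algebra_simps)
  qed
qed simp

lemma simplex_lattice_tetrahedron: "simplex_lattice 3 tetrahedron"
proof
  show "tetrahedron i \<bullet> tetrahedron j = (if i = j then 2 else 0) - 2 / (real 3 + 1)"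
    if "i \<le> 3" "j \<le> 3" for i j
    using that unfolding le_3_cases
    by (elim disjE) (simp_all add: inner_tetrahedron tetrahedron_component)
  show "(\<Sum>i\<le>3. (y \<bullet> tetrahedron i)\<^sup>2) = 2 * (norm y)\<^sup>2" for y
  proof -
    have "(norm y)\<^sup>2 = y $ 1 * y $ 1 + y $ 2 * y $ 2 + y $ 3 * y $ 3"
      unfolding power2_norm_eq_inner by (simp add: inner_vec_def sum_3)
    then show ?thesis
      unfolding atMost_3 by (simp add: inner_tetrahedron power2_eq_square algebra_simps)
  qed
qed simp

text \<open>The point with parameters \<open>i\<close>, \<open>j\<close> has the integer coordinates
  \<open>- i - j\<close>, \<open>i\<close>, \<open>j\<close>.\<close>

lemma L_triangle:
  "simplex_lattice.L 2 triangle = {vector [2 * of_int i + of_int j, sqrt 3 * of_int j] | i j :: int. True}"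
proof (intro set_eqI iffI)
  fix x assume "x \<in> simplex_lattice.L 2 triangle"
  then have "x \<bullet> triangle (Suc 0) / 2 \<in> \<int>" "x \<bullet> triangle 2 / 2 \<in> \<int>"
    unfolding simplex_lattice.L_def[OF simplex_lattice_triangle] by auto
  then obtain i j where ij: "x \<bullet> triangle (Suc 0) / 2 = of_int i" "x \<bullet> triangle 2 / 2 = of_int j"
    unfolding Ints_def by auto
  have j: "sqrt 3 / 3 * x $ 2 = of_int j" using ij(2) unfolding inner_triangle by simp
  then have "sqrt 3 * (sqrt 3 / 3 * x $ 2) = sqrt 3 * of_int j" by (rule arg_cong)
  moreover have "sqrt 3 * (sqrt 3 / 3 * x $ 2) = x $ 2" by simp
  ultimately have "x $ 2 = sqrt 3 * of_int j" by (rule trans[OF sym, rotated])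
  moreover have "x $ 1 = 2 * of_int i + of_int j" using ij(1) j unfolding inner_triangle by simp
  ultimately have "x = vector [2 * of_int i + of_int j, sqrt 3 * of_int j]"
    by (simp add: vec_eq_iff forall_2)
  then show "x \<in> {vector [2 * of_int i + of_int j, sqrt 3 * of_int j] | i j :: int. True}" by blast
next
  fix x :: "real^2"
  assume "x \<in> {vector [2 * of_int i + of_int j, sqrt 3 * of_int j] | i j :: int. True}"
  then obtain i j :: int where x: "x = vector [2 * of_int i + of_int j, sqrt 3 * of_int j]" by blast
  have "x \<bullet> triangle 0 / 2 = of_int (- i - j)" "x \<bullet> triangle (Suc 0) / 2 = of_int i"
    "x \<bullet> triangle 2 / 2 = of_int j"
    unfolding inner_triangle x by (simp_all add: field_simps)
  then show "x \<in> simplex_lattice.L 2 triangle"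
    unfolding simplex_lattice.L_def[OF simplex_lattice_triangle] le_2_cases
    by (auto simp only: Ints_of_int mem_Collect_eq)
qed

text \<open>The point with parameters \<open>i\<close>, \<open>j\<close>, \<open>k\<close> has the
  integer coordinates \<open>- i - k\<close>, \<open>i\<close>, \<open>j + k\<close>,
  \<open>- j\<close>.\<close>

lemma L_tetrahedron:
  "simplex_lattice.L 3 tetrahedron =
     {vector [2 * of_int i + of_int k, 2 * of_int j + of_int k, sqrt 2 * of_int k] | i j k :: int. True}"
proof (intro set_eqI iffI)
  fix x assume "x \<in> simplex_lattice.L 3 tetrahedron"
  then have "x \<bullet> tetrahedron (Suc 0) / 2 \<in> \<int>" "x \<bullet> tetrahedron 2 / 2 \<in> \<int>" "x \<bullet> tetrahedron 3 / 2 \<in> \<int>"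
    unfolding simplex_lattice.L_def[OF simplex_lattice_tetrahedron] by auto
  then obtain i l m where il: "x \<bullet> tetrahedron (Suc 0) / 2 = of_int i"
    "x \<bullet> tetrahedron 2 / 2 = of_int l" "x \<bullet> tetrahedron 3 / 2 = of_int m"
    unfolding Ints_def by auto
  \<comment> \<open>The last two coordinates, \<open>j + k\<close> and \<open>- j\<close>, add up to
    \<open>k\<close>.\<close>
  define k where "k = l + m"
  have k: "sqrt 2 / 2 * x $ 3 = of_int k" using il(2,3) unfolding inner_tetrahedron k_def by simp
  then have "sqrt 2 * (sqrt 2 / 2 * x $ 3) = sqrt 2 * of_int k" by simp
  moreover have "sqrt 2 * (sqrt 2 / 2 * x $ 3) = x $ 3" by simp
  ultimately have "x $ 3 = sqrt 2 * of_int k" by (rule trans[OF sym, rotated])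
  moreover have "x $ 1 = 2 * of_int i + of_int k" using il(1) k unfolding inner_tetrahedron by simp
  moreover have "x $ 2 = 2 * of_int (- m) + of_int k" using il(3) k unfolding inner_tetrahedron by simp
  ultimately have "x = vector [2 * of_int i + of_int k, 2 * of_int (- m) + of_int k, sqrt 2 * of_int k]"
    by (simp add: vec_eq_iff forall_3)
  then show "x \<in> {vector [2 * of_int i + of_int k, 2 * of_int j + of_int k, sqrt 2 * of_int k]
      | i j k :: int. True}" by blast
next
  fix x :: "real^3"
  assume "x \<in> {vector [2 * of_int i + of_int k, 2 * of_int j + of_int k, sqrt 2 * of_int k]
      | i j k :: int. True}"
  then obtain i j k :: int where
    x: "x = vector [2 * of_int i + of_int k, 2 * of_int j + of_int k, sqrt 2 * of_int k]" by blast
  have "x \<bullet> tetrahedron 0 / 2 = of_int (- i - k)" "x \<bullet> tetrahedron (Suc 0) / 2 = of_int i"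
    "x \<bullet> tetrahedron 2 / 2 = of_int (j + k)" "x \<bullet> tetrahedron 3 / 2 = of_int (- j)"
    unfolding inner_tetrahedron x by (simp_all add: field_simps)
  then show "x \<in> simplex_lattice.L 3 tetrahedron"
    unfolding simplex_lattice.L_def[OF simplex_lattice_tetrahedron] le_3_cases
    by (auto simp only: Ints_of_int mem_Collect_eq)
qed

theorem theorem1:
  shows "(\<forall>(C :: (real^2) set) H P v.
            honeycomb_packing C \<and> gap_data H P v \<longrightarrow>
            \<not> completely_saturated (gap_defect C P v)) \<and>
         (\<forall>(B :: (real^3) set) H P v.
            fcc_packing B \<and> gap_data H P v \<longrightarrow>
            \<not> completely_saturated (gap_defect B P v))"
  using gap_defect_not_completely_saturated[OF simplex_lattice_triangle]
    gap_defect_not_completely_saturated[OF simplex_lattice_tetrahedron]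
  unfolding L_triangle L_tetrahedron honeycomb_packing_def fcc_packing_def by blast

end
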